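(* Let $\mathfrak{H}$ be a (finite or infinite dimensional) complex Hilbert space and let $A,B\in B(\mathfrak{H})$ be two positive operators such that $A$ is invertible. If $A\trianglelefteq B$ and $B\trianglelefteq A$, that is, if $$\langle A^{1/2}\xi,\xi\rangle\leq\langle B\xi,\xi\rangle^{1/2}\quad\text{and}\quad\langle B^{1/2}\xi,\xi\rangle\leq\langle A\xi,\xi\rangle^{1/2}$$ for every unit vector $\xi\in\mathfrak{H}$, then $A=B$.
   Context: $B(\mathfrak{H})$ denotes the algebra of all bounded linear operators on $\mathfrak{H}$. A positive operator is a bounded operator $A$ with $\langle A\xi,\xi\rangle\ge 0$ for all $\xi\in\mathfrak{H}$ (not necessarily invertible), and $A^{1/2}$ is its positive square root. Invertible means having a bounded inverse. For positive operators $A,B$, the relation $A\trianglelefteq B$ means $\langle A^{1/2}\xi,\xi\rangle\leq\langle B\xi,\xi\rangle^{1/2}$ for every unit vector $\xi\in\mathfrak{H}$. *)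

theory Defs
  imports "HOL-Analysis.Analysis"
begin

text \<open>
  Complex Hilbert spaces of arbitrary dimension. The norm, the topology and the completeness are
  those of the library class \<open>banach\<close>; the norm is the one given by the inner product. The inner
  product is linear in its first and conjugate linear in its second argument.
\<close>

class complex_hilbert_space = banach +
  fixes scaleC :: "complex \<Rightarrow> 'a \<Rightarrow> 'a" (infixr "*\<^sub>C" 75)
    and cinner :: "'a \<Rightarrow> 'a \<Rightarrow> complex"
  assumes scaleC_add_right: "c *\<^sub>C (x + y) = c *\<^sub>C x + c *\<^sub>C y"
    and scaleC_add_left: "(c + d) *\<^sub>C x = c *\<^sub>C x + d *\<^sub>C x"
    and scaleC_scaleC: "c *\<^sub>C d *\<^sub>C x = (c * d) *\<^sub>C x"
    and scaleC_one: "1 *\<^sub>C x = x"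
    and scaleR_eq_scaleC: "r *\<^sub>R x = complex_of_real r *\<^sub>C x"
    and cinner_commute: "cinner x y = cnj (cinner y x)"
    and cinner_add_left: "cinner (x + y) z = cinner x z + cinner y z"
    and cinner_scaleC_left: "cinner (c *\<^sub>C x) y = c * cinner x y"
    and cinner_self_nonneg: "cinner x x \<in> \<real>\<^sub>\<ge>\<^sub>0"
    and cinner_self_eq_0_iff: "cinner x x = 0 \<longleftrightarrow> x = 0"
    and norm_eq_sqrt_cinner: "norm x = sqrt (Re (cinner x x))"

instantiation complex :: complex_hilbert_space
begin

definition scaleC_complex :: "complex \<Rightarrow> complex \<Rightarrow> complex"
  where "scaleC_complex c x = c * x"

definition cinner_complex :: "complex \<Rightarrow> complex \<Rightarrow> complex"
  where "cinner_complex x y = x * cnj y"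

instance
  by standard
    (auto simp: scaleC_complex_def cinner_complex_def algebra_simps scaleR_conv_of_real
      complex_nonneg_Reals_iff cmod_def power2_eq_square)

end

definition bounded_clinear ::
    "('a::complex_hilbert_space \<Rightarrow> 'a) \<Rightarrow> bool"
  where "bounded_clinear A \<longleftrightarrow> bounded_linear A \<and> (\<forall>c x. A (c *\<^sub>C x) = c *\<^sub>C A x)"

definition positive_op :: "('a::complex_hilbert_space \<Rightarrow> 'a) \<Rightarrow> bool"
  where "positive_op A \<longleftrightarrow> bounded_clinear A \<and> (\<forall>x. cinner (A x) x \<in> \<real>\<^sub>\<ge>\<^sub>0)"

definition invertible_op :: "('a::complex_hilbert_space \<Rightarrow> 'a) \<Rightarrow> bool"
  where "invertible_op A \<longleftrightarrow> (\<exists>C. bounded_clinear C \<and> A \<circ> C = id \<and> C \<circ> A = id)"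

text \<open>Only meaningful for positive \<open>A\<close>, which has exactly one positive square root.\<close>

definition sqrt_op :: "('a::complex_hilbert_space \<Rightarrow> 'a) \<Rightarrow> 'a \<Rightarrow> 'a"
  where "sqrt_op A = (THE S. positive_op S \<and> S \<circ> S = A)"

text \<open>
  For positive \<open>A\<close> and \<open>B\<close> both inner products are nonnegative real numbers, so taking
  real parts loses nothing.
\<close>

definition root_quad_le ::
    "('a::complex_hilbert_space \<Rightarrow> 'a) \<Rightarrow> ('a \<Rightarrow> 'a) \<Rightarrow> bool" (infix "\<unlhd>" 50)
  where "A \<unlhd> B \<longleftrightarrow>
    (\<forall>x. norm x = 1 \<longrightarrow> Re (cinner (sqrt_op A x) x) \<le> sqrt (Re (cinner (B x) x)))"

end

theory Submission imports Defs begin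

text \<open>
  Let \<open>S = sqrt_op A\<close>, \<open>T = sqrt_op B\<close> and \<open>D = T - S\<close>. By the arithmetic-geometric mean inequality the two
  hypotheses say \<open>2 u T \<le> S\<^sup>2 + u\<^sup>2\<close> and \<open>2 u S \<le> T\<^sup>2 + u\<^sup>2\<close> for all \<open>u > 0\<close>. If \<open>S \<ge> s > 0\<close> and
  \<open>s \<le> u \<le> 2 s\<close>, they imply \<open>- (S - u)\<^sup>2 / s \<le> D \<le> (S - u)\<^sup>2 / s\<close>, hence
  \<open>\<parallel>D x\<parallel> \<le> K \<parallel>(S - u) x\<parallel>\<close> with \<open>K\<close> independent of \<open>u\<close>. So \<open>\<parallel>D x\<parallel> \<le> K \<epsilon> \<parallel>x\<parallel>\<close> on a spectral
  subspace of \<open>S\<close> belonging to an interval of length \<open>\<epsilon>\<close> inside \<open>[s, 2 s]\<close>; adding up \<open>s / \<epsilon>\<close> mutually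
  orthogonal pieces costs only a factor \<open>sqrt (s / \<epsilon>)\<close>, so \<open>D = 0\<close> on the spectral subspace of
  \<open>[s, 2 s]\<close>. That subspace reduces \<open>S\<close> and \<open>T\<close>, and on its complement \<open>S \<ge> 2 s\<close>, so finitely many
  repetitions exhaust the spectrum of the bounded operator \<open>S\<close>.
\<close>

section \<open>The underlying real Hilbert space\<close>

text \<open>The real part turns the space into a real Hilbert space with the same norm, so the
  argument can run on bounded real-linear maps; complex linearity returns only when
  \<open>sqrt_op\<close> is identified.\<close>

definition rinner :: "'a::complex_hilbert_space \<Rightarrow> 'a \<Rightarrow> real"
  where "rinner x y = Re (cinner x y)"

lemma rinner_commute: "rinner x y = rinner y x"
  by (metis cinner_commute rinner_def cnj.sel(1))

lemma rinner_add_left: "rinner (x + y) z = rinner x z + rinner y z"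
  by (simp add: rinner_def cinner_add_left)

lemma rinner_scaleR_left: "rinner (r *\<^sub>R x) y = r * rinner x y"
  by (simp add: rinner_def scaleR_eq_scaleC cinner_scaleC_left)

lemma rinner_add_right: "rinner z (x + y) = rinner z x + rinner z y"
  by (metis rinner_commute rinner_add_left)

lemma rinner_scaleR_right: "rinner y (r *\<^sub>R x) = r * rinner y x"
  by (metis rinner_commute rinner_scaleR_left)

lemma rinner_self: "rinner x x = (norm x)\<^sup>2"
proof -
  have "Re (cinner x x) \<ge> 0"
    using cinner_self_nonneg[of x] by (auto simp: complex_nonneg_Reals_iff)
  then show ?thesis
    by (simp add: rinner_def norm_eq_sqrt_cinner)
qed

lemma discriminant_bound:
  fixes a b c :: real
  assumes nonneg: "\<And>t. 0 \<le> a + 2 * t * b + t\<^sup>2 * c"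
  shows "b\<^sup>2 \<le> a * c"
proof (cases "c = 0")
  case True
  have "b = 0"
  proof (rule ccontr)
    assume "b \<noteq> 0"
    \<comment> \<open>The chosen value of \<open>t\<close> makes the affine function equal to
      -1.\<close>
    then show False
      using nonneg[of "- (a + 1) / (2 * b)"] True by (simp add: field_simps)
  qed
  then show ?thesis using True by simp
next
  case False
  have "c \<ge> 0"
  proof (rule ccontr)
    assume "\<not> c \<ge> 0"
    have a: "a \<ge> 0" using nonneg[of 0] by simp
    \<comment> \<open>With this choice the values of the quadratic at \<open>t\<close> and
      \<open>- t\<close> add up to -2.\<close>
    define t where "t = sqrt ((a + 1) / (- c))"
    have "t\<^sup>2 = (a + 1) / (- c)"
      using a \<open>\<not> c \<ge> 0\<close> unfolding t_def by (simp add: divide_nonneg_neg divide_nonneg_nonneg)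
    then have "t\<^sup>2 * c = - (a + 1)" using False by simp
    then show False using nonneg[of t] nonneg[of "- t"] by simp
  qed
  then have c: "c > 0" using False by simp
  \<comment> \<open>The quadratic attains its minimum at \<open>- b / c\<close>.\<close>
  have "0 \<le> c * (a + 2 * (- b / c) * b + (- b / c)\<^sup>2 * c)"
    using nonneg[of "- b / c"] c by (intro mult_nonneg_nonneg) auto
  also have "\<dots> = a * c - b\<^sup>2"
    using c by (simp add: field_simps power2_eq_square)
  finally show ?thesis by simp
qed

lemma rinner_abs_le: "\<bar>rinner x y\<bar> \<le> norm x * norm y"
proof -
  have "0 \<le> rinner x x + 2 * t * rinner x y + t\<^sup>2 * rinner y y" for t
    using rinner_self[of "x + t *\<^sub>R y"]
    by (simp add: rinner_add_left rinner_add_right rinner_scaleR_left rinner_scaleR_right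
        rinner_commute[of y x] power2_eq_square algebra_simps)
  then have "(rinner x y)\<^sup>2 \<le> rinner x x * rinner y y"
    by (rule discriminant_bound)
  then have "(rinner x y)\<^sup>2 \<le> (norm x * norm y)\<^sup>2"
    by (simp add: rinner_self power_mult_distrib)
  then show ?thesis
    by (metis abs_le_square_iff abs_mult abs_norm_cancel)
qed

interpretation rinner: bounded_bilinear rinner
  by standard
     (auto simp: rinner_add_left rinner_add_right rinner_scaleR_left rinner_scaleR_right
       intro!: exI[of _ 1] rinner_abs_le)

declare rinner.zero_left [simp] rinner.zero_right [simp]

section \<open>Positive semidefinite operators and their square roots\<close>

definition sym_op :: "('a::complex_hilbert_space \<Rightarrow>\<^sub>L 'a) \<Rightarrow> bool"
  where "sym_op A \<longleftrightarrow> (\<forall>x y. rinner (A x) y = rinner x (A y))"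

text \<open>Symmetry is demanded explicitly because over the reals a nonnegative form does not imply
  it.\<close>

definition psd_op :: "('a::complex_hilbert_space \<Rightarrow>\<^sub>L 'a) \<Rightarrow> bool"
  where "psd_op A \<longleftrightarrow> sym_op A \<and> (\<forall>x. 0 \<le> rinner (A x) x)"

definition commuting :: "('a::real_normed_vector \<Rightarrow>\<^sub>L 'a) \<Rightarrow> ('a \<Rightarrow>\<^sub>L 'a) \<Rightarrow> bool"
  where "commuting A B \<longleftrightarrow> (\<forall>x. A (B x) = B (A x))"

lemma sym_opD: "sym_op A \<Longrightarrow> rinner (A x) y = rinner x (A y)"
  by (simp add: sym_op_def)

lemma commutingD: "commuting A B \<Longrightarrow> A (B x) = B (A x)"
  by (simp add: commuting_def)

lemma psd_opD: "psd_op A \<Longrightarrow> sym_op A" "psd_op A \<Longrightarrow> 0 \<le> rinner (A x) x"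
  by (simp_all add: psd_op_def)

lemmas op_simps = blinfun.bilinear_simps rinner.add_left rinner.add_right rinner.diff_left
  rinner.diff_right rinner.minus_left rinner.minus_right rinner.scaleR_left rinner.scaleR_right

lemma sym_op_intros [intro]:
  "sym_op id_blinfun"
  "sym_op A \<Longrightarrow> sym_op B \<Longrightarrow> sym_op (A + B)"
  "sym_op A \<Longrightarrow> sym_op B \<Longrightarrow> sym_op (A - B)"
  "sym_op A \<Longrightarrow> sym_op (r *\<^sub>R A)"
  "sym_op A \<Longrightarrow> sym_op B \<Longrightarrow> commuting A B \<Longrightarrow> sym_op (A o\<^sub>L B)"
  by (simp_all add: sym_op_def op_simps commuting_def)

lemma commuting_intros [intro]:
  "commuting A id_blinfun"
  "commuting A A"
  "commuting A B \<Longrightarrow> commuting A C \<Longrightarrow> commuting A (B + C)"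
  "commuting A B \<Longrightarrow> commuting A C \<Longrightarrow> commuting A (B - C)"
  "commuting A B \<Longrightarrow> commuting A (r *\<^sub>R B)"
  "commuting A B \<Longrightarrow> commuting A C \<Longrightarrow> commuting A (B o\<^sub>L C)"
  by (simp_all add: op_simps commuting_def)

lemma blinfun_compose_eqD: "A o\<^sub>L B = C \<Longrightarrow> A (B x) = C x"
  by auto

lemma commuting_sym: "commuting A B \<Longrightarrow> commuting B A"
  by (simp add: commuting_def)

lemma psd_op_Cauchy_Schwarz:
  assumes "psd_op A"
  shows "(rinner (A x) y)\<^sup>2 \<le> rinner (A x) x * rinner (A y) y"
proof (rule discriminant_bound)
  fix t
  have "rinner (A y) x = rinner (A x) y"
    using assms by (metis psd_opD(1) sym_opD rinner_commute)
  then show "0 \<le> rinner (A x) x + 2 * t * rinner (A x) y + t\<^sup>2 * rinner (A y) y"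
    using psd_opD(2)[OF assms, of "x + t *\<^sub>R y"]
    by (simp add: op_simps power2_eq_square algebra_simps)
qed

text \<open>Cauchy-Schwarz for the form of \<open>A\<close> at \<open>x\<close> and
  \<open>A x\<close>, followed by cancellation. It turns a small value of the form into a small
  vector \<open>A x\<close>.\<close>

lemma psd_op_norm_sq_le:
  assumes A: "psd_op A" and le: "\<And>x. rinner (A x) x \<le> c * (norm x)\<^sup>2"
  shows "(norm (A x))\<^sup>2 \<le> c * rinner (A x) x"
proof (cases "A x = 0")
  case False
  have "((norm (A x))\<^sup>2)\<^sup>2 \<le> rinner (A x) x * rinner (A (A x)) (A x)"
    using psd_op_Cauchy_Schwarz[OF A, of x "A x"] by (simp add: rinner_self)
  also have "\<dots> \<le> rinner (A x) x * (c * (norm (A x))\<^sup>2)"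
    by (rule mult_left_mono[OF le psd_opD(2)[OF A]])
  finally have "(norm (A x))\<^sup>2 * (norm (A x))\<^sup>2 \<le> (c * rinner (A x) x) * (norm (A x))\<^sup>2"
    by (simp add: power2_eq_square algebra_simps)
  then show ?thesis
    using False by (meson mult_right_le_imp_le zero_less_norm_iff zero_less_power)
qed (simp add: op_simps)

lemma rinner_le_norm_blinfun:
  fixes A :: "'a::complex_hilbert_space \<Rightarrow>\<^sub>L 'a"
  shows "rinner (A x) x \<le> norm A * (norm x)\<^sup>2"
proof -
  have "rinner (A x) x \<le> norm (A x) * norm x"
    using rinner_abs_le[of "A x" x] by simp
  also have "\<dots> \<le> (norm A * norm x) * norm x"
    by (rule mult_right_mono[OF norm_blinfun]) simp
  finally show ?thesis by (simp add: power2_eq_square algebra_simps)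
qed

lemma psd_op_norm_le:
  assumes A: "psd_op A" and le: "\<And>x. rinner (A x) x \<le> c * (norm x)\<^sup>2" and "c \<ge> 0"
  shows "norm (A x) \<le> c * norm x"
proof -
  have "(norm (A x))\<^sup>2 \<le> c * rinner (A x) x"
    by (rule psd_op_norm_sq_le[OF A le])
  also have "\<dots> \<le> c * (c * (norm x)\<^sup>2)"
    using le \<open>c \<ge> 0\<close> by (rule mult_left_mono)
  finally have "(norm (A x))\<^sup>2 \<le> (c * norm x)\<^sup>2"
    by (simp add: power2_eq_square algebra_simps)
  then show ?thesis
    using \<open>c \<ge> 0\<close> by (meson mult_nonneg_nonneg norm_ge_zero power2_le_imp_le)
qed

lemma psd_op_eq_0:
  assumes "psd_op A" "rinner (A x) x = 0"
  shows "A x = 0"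
  using psd_op_norm_sq_le[OF assms(1) rinner_le_norm_blinfun, of x] assms(2) by simp

text \<open>For \<open>R = id_blinfun - V\<close> the equation becomes V = (Z + V^2) / 2. The
  iterates starting at 0 are polynomials in \<open>Z\<close>, and their increments are dominated by
  those of a bounded increasing scalar sequence, so they converge in norm; the limit commutes with
  whatever commutes with \<open>Z\<close>.\<close>

lemma psd_op_sqrt_exists_contraction:
  fixes Z :: "'a::complex_hilbert_space \<Rightarrow>\<^sub>L 'a"
  assumes Z: "sym_op Z" "norm Z \<le> 1"
  obtains R where "psd_op R" "R o\<^sub>L R = id_blinfun - Z"
    "\<And>C. commuting C Z \<Longrightarrow> commuting C R"
proof -
  define Y where "Y = rec_nat (0 :: 'a \<Rightarrow>\<^sub>L 'a) (\<lambda>_ V. (1/2) *\<^sub>R (Z + (V o\<^sub>L V)))"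
  \<comment> \<open>The scalar majorant: the same recursion with \<open>Z\<close> replaced by 1, the
    bound on its norm.\<close>
  define y where "y = rec_nat (0 :: real) (\<lambda>_ v. (1 + v\<^sup>2) / 2)"
  have Y0: "Y 0 = 0" and YS: "Y (Suc n) = (1/2) *\<^sub>R (Z + (Y n o\<^sub>L Y n))" for n
    by (simp_all add: Y_def)
  have y0: "y 0 = 0" and yS: "y (Suc n) = (1 + (y n)\<^sup>2) / 2" for n
    by (simp_all add: y_def)
  have y_range: "0 \<le> y n \<and> y n \<le> 1" for n
  proof (induction n)
    case (Suc n)
    then have "(y n)\<^sup>2 \<le> 1" by (simp add: power_le_one)
    then show ?case by (simp add: yS)
  qed (simp add: y0)
  have Y_norm: "norm (Y n) \<le> y n" for n
  proof (induction n)
    case (Suc n)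
    have "norm (Z + (Y n o\<^sub>L Y n)) \<le> norm Z + norm (Y n o\<^sub>L Y n)"
      by (rule norm_triangle_ineq)
    also have "\<dots> \<le> 1 + norm (Y n) * norm (Y n)"
      by (intro add_mono Z norm_blinfun_compose)
    also have "\<dots> \<le> 1 + (y n)\<^sup>2"
      using Suc by (simp add: power2_eq_square mult_mono')
    finally show ?case by (simp add: YS yS)
  qed (simp add: Y0 y0)
  have Y_step: "norm (Y (Suc n) - Y n) \<le> y (Suc n) - y n" for n
  proof (induction n)
    case 0
    then show ?case using Z by (simp add: Y0 YS y0 yS)
  next
    case (Suc n)
    \<comment> \<open>The splitting V^2 - W^2 = V (V - W) + (V - W) W requires no
      commutation.\<close>
    have "Y (Suc (Suc n)) - Y (Suc n)
      = (1/2) *\<^sub>R ((Y (Suc n) o\<^sub>L (Y (Suc n) - Y n)) + ((Y (Suc n) - Y n) o\<^sub>L Y n))"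
      unfolding YS[of "Suc n"] YS[of n, THEN arg_cong[where f="\<lambda>v. _ - v"]]
      by (rule blinfun_eqI) (simp add: op_simps algebra_simps)
    also have "norm \<dots> \<le> (1/2) * (norm (Y (Suc n)) * norm (Y (Suc n) - Y n)
        + norm (Y (Suc n) - Y n) * norm (Y n))"
      by (simp, intro norm_triangle_le add_mono norm_blinfun_compose)
    also have "\<dots> \<le> (1/2) * (y (Suc n) * (y (Suc n) - y n) + (y (Suc n) - y n) * y n)"
      using Suc order_trans[OF norm_ge_zero Suc] y_range
      by (intro mult_left_mono add_mono mult_mono Y_norm) auto
    also have "\<dots> = y (Suc (Suc n)) - y (Suc n)"
      unfolding yS[of "Suc n"] yS[of n, THEN arg_cong[where f="\<lambda>v. _ - v"]]
      by (simp add: field_simps power2_eq_square)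
    finally show ?case .
  qed
  have y_mono: "incseq y"
  proof (rule incseq_SucI)
    show "y n \<le> y (Suc n)" for n
      using Y_step[of n] norm_ge_zero[of "Y (Suc n) - Y n"] by linarith
  qed
  obtain l where l: "y \<longlonglongrightarrow> l"
    using incseq_convergent[OF y_mono, of 1] y_range by blast
  have Y_diff: "norm (Y (n + k) - Y n) \<le> y (n + k) - y n" for n k
  proof (induction k)
    case (Suc k)
    have "norm (Y (n + Suc k) - Y n) \<le> norm (Y (Suc (n + k)) - Y (n + k)) + norm (Y (n + k) - Y n)"
      using norm_triangle_ineq[of "Y (Suc (n + k)) - Y (n + k)" "Y (n + k) - Y n"] by simp
    then show ?case using Suc Y_step[of "n + k"] by simp
  qed simp
  have "Cauchy Y"
  proof (rule metric_CauchyI)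
    fix e :: real assume "e > 0"
    then obtain M where M: "\<And>m n. m \<ge> M \<Longrightarrow> n \<ge> M \<Longrightarrow> dist (y m) (y n) < e"
      using LIMSEQ_imp_Cauchy[OF l] unfolding Cauchy_def by metis
    have "dist (Y m) (Y n) < e" if "n \<le> m" "n \<ge> M" for m n
      using Y_diff[of n "m - n"] M[of m n] that by (simp add: dist_norm)
    then show "\<exists>M. \<forall>m\<ge>M. \<forall>n\<ge>M. dist (Y m) (Y n) < e"
      by (metis dist_commute nle_le)
  qed
  then obtain V where V: "Y \<longlonglongrightarrow> V"
    using Cauchy_convergent_iff convergent_def by blast
  note apply_lim = blinfun.tendsto[OF V tendsto_const]
  have "(\<lambda>n. Y (Suc n)) \<longlonglongrightarrow> (1/2) *\<^sub>R (Z + (V o\<^sub>L V))"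
    unfolding YS
    by (intro tendsto_intros bounded_bilinear.tendsto[OF bounded_bilinear_blinfun_compose] V)
  then have fixpoint: "V = (1/2) *\<^sub>R (Z + (V o\<^sub>L V))"
    using V LIMSEQ_Suc LIMSEQ_unique by blast
  have V_norm: "norm V \<le> 1"
    using Y_norm y_range by (intro Lim_bounded[OF tendsto_norm[OF V], of 0]) (meson order_trans)
  have Y_comm: "commuting C (Y n)" if "commuting C Z" for C n
    by (induction n) (auto simp: Y0 YS commuting_def op_simps that[unfolded commuting_def])
  have V_comm: "commuting C V" if "commuting C Z" for C
    unfolding commuting_def
  proof
    fix x
    have "(\<lambda>n. C (Y n x)) \<longlonglongrightarrow> C (V x)"
      by (intro blinfun.tendsto tendsto_const apply_lim)
    moreover have "(\<lambda>n. C (Y n x)) \<longlonglongrightarrow> V (C x)"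
      using apply_lim[of "C x"] commutingD[OF Y_comm[OF that]] by simp
    ultimately show "C (V x) = V (C x)" by (rule LIMSEQ_unique)
  qed
  have Y_sym: "sym_op (Y n)" for n
    by (induction n) (auto simp: Y0 YS sym_op_def op_simps sym_opD[OF Z(1)])
  have V_sym: "sym_op V"
    unfolding sym_op_def
  proof (intro allI)
    fix x z
    have "(\<lambda>n. rinner (Y n x) z) \<longlonglongrightarrow> rinner (V x) z" "(\<lambda>n. rinner x (Y n z)) \<longlonglongrightarrow> rinner x (V z)"
      by (intro rinner.tendsto tendsto_const apply_lim)+
    then show "rinner (V x) z = rinner x (V z)"
      using sym_opD[OF Y_sym] LIMSEQ_unique by simp
  qed
  show thesis
  proof
    have "rinner (V x) x \<le> rinner x x" for x
      using rinner_le_norm_blinfun[of V x] mult_right_mono[OF V_norm, of "(norm x)\<^sup>2"]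
      by (simp add: rinner_self)
    then show "psd_op (id_blinfun - V)"
      using V_sym by (auto simp: psd_op_def op_simps)
    have "2 *\<^sub>R V x = Z x + V (V x)" for x
      by (subst (1) fixpoint) (simp add: op_simps)
    then have "V x + V x = Z x + V (V x)" for x
      by (simp add: scaleR_2)
    then show "(id_blinfun - V) o\<^sub>L (id_blinfun - V) = id_blinfun - Z"
      by (intro blinfun_eqI) (simp add: op_simps algebra_simps)
    show "commuting C (id_blinfun - V)" if "commuting C Z" for C
      using V_comm[OF that] by auto
  qed
qed

text \<open>Scaling makes Z = id - A / c a contraction, and the root of A / c is scaled back by
  \<open>sqrt c\<close>. The summand 1 in \<open>c\<close> keeps it positive for
  \<open>A = 0\<close>.\<close>

lemma psd_op_sqrt_exists:
  fixes A :: "'a::complex_hilbert_space \<Rightarrow>\<^sub>L 'a"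
  assumes A: "psd_op A"
  obtains R where "psd_op R" "R o\<^sub>L R = A" "\<And>C. commuting C A \<Longrightarrow> commuting C R"
proof -
  define c where "c = norm A + 1"
  have c: "c > 0" by (simp add: c_def add_nonneg_pos)
  define Z where "Z = id_blinfun - (1/c) *\<^sub>R A"
  have Ac: "rinner (A x) x \<le> c * (norm x)\<^sup>2" for x
    using rinner_le_norm_blinfun[of A x] zero_le_power2[of "norm x"]
    unfolding c_def distrib_right by linarith
  have Z: "sym_op Z" using psd_opD(1)[OF A] by (auto simp: Z_def)
  have "0 \<le> rinner (Z x) x \<and> rinner (Z x) x \<le> 1 * (norm x)\<^sup>2" for x
    using c psd_opD(2)[OF A, of x] Ac[of x] by (simp add: Z_def op_simps rinner_self field_simps)
  then have "norm (Z x) \<le> 1 * norm x" for x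
    using Z by (intro psd_op_norm_le) (auto simp: psd_op_def)
  then have "norm Z \<le> 1"
    by (intro norm_blinfun_bound) auto
  then obtain R where R: "psd_op R" "R o\<^sub>L R = id_blinfun - Z"
    "\<And>C. commuting C Z \<Longrightarrow> commuting C R"
    using psd_op_sqrt_exists_contraction[OF Z] by metis
  show thesis
  proof
    show "psd_op (sqrt c *\<^sub>R R)"
      using R(1) c by (auto simp: psd_op_def op_simps)
    have "R (R x) = (1/c) *\<^sub>R A x" for x
      using blinfun_compose_eqD[OF R(2), of x] by (simp add: Z_def op_simps)
    then show "(sqrt c *\<^sub>R R) o\<^sub>L (sqrt c *\<^sub>R R) = A"
      using c by (intro blinfun_eqI) (simp add: op_simps)
    show "commuting C (sqrt c *\<^sub>R R)" if "commuting C A" for C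
      using R(3)[of C] that by (auto simp: Z_def)
  qed
qed

text \<open>For y = (R - S) x, commutation gives (R + S) y = R^2 x - S^2 x = 0. Both forms are
  nonnegative, so both vanish at \<open>y\<close>; hence R y = S y = 0 and |y|^2 = <x, (R - S) y> =
  0.\<close>

lemma psd_op_sqrt_unique_commuting:
  assumes R: "psd_op R" and S: "psd_op S" and eq: "R o\<^sub>L R = S o\<^sub>L S" and comm: "commuting S R"
  shows "R = S"
proof (rule blinfun_eqI)
  fix x
  define y where "y = R x - S x"
  have "R (R x) = S (S x)"
    using blinfun_compose_eqD[OF eq, of x] by simp
  then have "R y + S y = 0"
    by (simp add: y_def op_simps commutingD[OF comm])
  then have "rinner (R y) y + rinner (S y) y = 0"
    by (metis rinner.add_left rinner.zero_left)
  then have "rinner (R y) y = 0" "rinner (S y) y = 0"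
    using psd_opD(2)[OF R, of y] psd_opD(2)[OF S, of y] by linarith+
  then have "R y = 0" "S y = 0"
    using psd_op_eq_0 R S by blast+
  moreover have "rinner y y = rinner x (R y - S y)"
    by (subst (1) y_def) (simp add: op_simps sym_opD[OF psd_opD(1)[OF R]] sym_opD[OF psd_opD(1)[OF S]])
  ultimately have "rinner y y = 0"
    by (simp add: op_simps)
  then show "R x = S x"
    by (simp add: rinner_self y_def)
qed

text \<open>The constructed root \<open>V\<close> of the common square commutes with everything that
  commutes with this square, in particular with \<open>R\<close> and \<open>S\<close>; so each of
  them equals \<open>V\<close>.\<close>

lemma psd_op_sqrt_unique:
  assumes "psd_op R" "psd_op S" "R o\<^sub>L R = S o\<^sub>L S"
  shows "R = S"
proof -
  have "psd_op (R o\<^sub>L R)"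
    using assms(1) by (auto simp: psd_op_def sym_op_def rinner_self)
  then obtain V where V: "psd_op V" "V o\<^sub>L V = R o\<^sub>L R"
    "\<And>C. commuting C (R o\<^sub>L R) \<Longrightarrow> commuting C V"
    by (rule psd_op_sqrt_exists) blast
  have "commuting R V" by (intro V) auto
  moreover have "commuting S V" unfolding assms(3) by (intro V, unfold assms(3)) auto
  ultimately show ?thesis
    using psd_op_sqrt_unique_commuting[of V] assms V by metis
qed

section \<open>Spectral projections\<close>

text \<open>The projection is the strong limit of the powers of \<open>id - G / c\<close> for large \<open>c\<close>; this makes
  it commute with everything that commutes with \<open>G\<close>.\<close>

lemma kernel_projection_exists:
  fixes G :: "'a::complex_hilbert_space \<Rightarrow>\<^sub>L 'a"
  assumes G: "psd_op G"
  obtains P where "sym_op P" "\<And>x. P (P x) = P x" "\<And>x. G (P x) = 0"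
    "\<And>x. G x = 0 \<Longrightarrow> P x = x" "\<And>C. commuting C G \<Longrightarrow> commuting C P"
proof -
  define c where "c = norm G + 1"
  have c: "c > 0" by (simp add: c_def add_nonneg_pos)
  \<comment> \<open>Now 0 <= V <= id, and the fixed vectors of \<open>V\<close> are exactly the
    kernel of \<open>G\<close>.\<close>
  define V where "V = id_blinfun - (1/c) *\<^sub>R G"
  have Gc: "rinner (G x) x \<le> c * (norm x)\<^sup>2" for x
    using rinner_le_norm_blinfun[of G x] zero_le_power2[of "norm x"]
    unfolding c_def distrib_right by linarith
  have V_sym: "sym_op V" using psd_opD(1)[OF G] by (auto simp: V_def)
  have V_range: "0 \<le> rinner (V x) x \<and> rinner (V x) x \<le> 1 * (norm x)\<^sup>2" for x
    using c psd_opD(2)[OF G, of x] Gc[of x] by (simp add: V_def op_simps rinner_self field_simps)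
  have V_psd: "psd_op V" using V_sym V_range by (simp add: psd_op_def)
  define p where "p n = ((o\<^sub>L) V ^^ n) id_blinfun" for n
  have p0: "p 0 x = x" and pS: "p (Suc n) x = V (p n x)" for n x
    by (simp_all add: p_def)
  have p_add: "p (m + n) x = p m (p n x)" for m n x
    by (induction m) (simp_all add: p0 pS)
  have p_comm: "commuting C (p n)" if "commuting C V" for C n
    by (induction n) (use that in \<open>auto simp: p0 pS commuting_def\<close>)
  have p_sym: "rinner (p n x) y = rinner x (p n y)" for n x y
    by (induction n arbitrary: x y)
       (simp_all add: p0 pS sym_opD[OF V_sym] commutingD[OF p_comm[of V]] commuting_intros)
  have V_norm: "norm (V x) \<le> norm x" for x
    using psd_op_norm_le[OF V_psd, of 1] V_range by simp
  have p_norm: "norm (p n x) \<le> norm x" for n x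
    by (induction n) (auto simp: p0 pS intro: order_trans[OF V_norm])
  have Cauchy_p: "Cauchy (\<lambda>n. p n x)" for x
  proof -
    \<comment> \<open>By symmetry <p m x, p n x> depends only on \<open>m + n\<close>, so
      convergence of the vectors reduces to that of one real sequence.\<close>
    define a where "a k = rinner (p k x) x" for k
    have a_add: "rinner (p m x) (p n x) = a (m + n)" for m n
      by (metis a_def p_add p_sym add.commute)
    have a_even: "a (n + n) = (norm (p n x))\<^sup>2" for n
      by (simp add: a_add[symmetric] rinner_self)
    have a_odd: "a (Suc (n + n)) = rinner (V (p n x)) (p n x)" for n
      using a_add[of "Suc n" n] by (simp add: pS)
    \<comment> \<open>Even steps decrease by V <= id, odd ones by V^2 <= V.\<close>
    have step: "0 \<le> a k \<and> a (Suc k) \<le> a k" for k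
    proof (cases "even k")
      case True
      then obtain n where "k = n + n" by (metis evenE mult_2)
      then show ?thesis using V_range[of "p n x"] by (simp add: a_even a_odd)
    next
      case False
      then obtain n where k: "k = Suc (n + n)" by (metis oddE mult_2 Suc_eq_plus1)
      have "(norm (V (p n x)))\<^sup>2 \<le> 1 * rinner (V (p n x)) (p n x)"
        using V_range by (intro psd_op_norm_sq_le V_psd) auto
      then show ?thesis
        using a_even[of "Suc n"] V_range[of "p n x"] by (simp add: k a_odd pS)
    qed
    have "decseq a" using step by (simp add: decseq_SucI)
    then obtain l where "a \<longlonglongrightarrow> l"
      using decseq_convergent[of a 0] step by blast
    then have Ca: "Cauchy a" by (rule LIMSEQ_imp_Cauchy)
    show ?thesis
    proof (rule metric_CauchyI)
      fix e :: real assume "e > 0"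
      then obtain M where M: "\<And>m n. m \<ge> M \<Longrightarrow> n \<ge> M \<Longrightarrow> \<bar>a m - a n\<bar> < e\<^sup>2 / 2"
        using Ca unfolding Cauchy_def dist_real_def by (metis half_gt_zero zero_less_power)
      have "dist (p m x) (p n x) < e" if "m \<ge> M" "n \<ge> M" for m n
      proof -
        \<comment> \<open>The square is a sum of two differences of values of \<open>a\<close>,
          hence the bound e^2 / 2 for each.\<close>
        have "(norm (p m x - p n x))\<^sup>2 = a (m + m) - 2 * a (m + n) + a (n + n)"
          by (simp add: rinner_self[symmetric] op_simps a_add add.commute)
        also have "\<dots> < e\<^sup>2"
          using M[of "m + m" "m + n", OF trans_le_add1 trans_le_add1]
            M[of "n + n" "m + n", OF trans_le_add1 trans_le_add1] that by linarith
        finally show ?thesis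
          using \<open>e > 0\<close> by (simp add: dist_norm power2_less_imp_less)
      qed
      then show "\<exists>M. \<forall>m\<ge>M. \<forall>n\<ge>M. dist (p m x) (p n x) < e" by blast
    qed
  qed
  define P where "P = Blinfun (\<lambda>x. lim (\<lambda>n. p n x))"
  have lim: "(\<lambda>n. p n x) \<longlonglongrightarrow> lim (\<lambda>n. p n x)" for x
    using Cauchy_p Cauchy_convergent_iff convergent_LIMSEQ_iff by blast
  have "bounded_linear (\<lambda>x. lim (\<lambda>n. p n x))"
  proof (rule bounded_linear_intro[where K = 1])
    show "lim (\<lambda>n. p n (x + y)) = lim (\<lambda>n. p n x) + lim (\<lambda>n. p n y)" for x y
      using tendsto_add[OF lim[of x] lim[of y]] by (simp add: op_simps limI)
    show "lim (\<lambda>n. p n (r *\<^sub>R x)) = r *\<^sub>R lim (\<lambda>n. p n x)" for r x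
      using tendsto_scaleR[OF tendsto_const lim[of x]] by (simp add: op_simps limI)
    show "norm (lim (\<lambda>n. p n x)) \<le> norm x * 1" for x
      using p_norm by (intro Lim_bounded[OF tendsto_norm[OF lim], of 0]) auto
  qed
  then have P_lim: "(\<lambda>n. p n x) \<longlonglongrightarrow> P x" for x
    using lim by (simp add: P_def bounded_linear_Blinfun_apply)
  have VP: "V (P x) = P x" for x
  proof (rule LIMSEQ_unique)
    show "(\<lambda>n. p (Suc n) x) \<longlonglongrightarrow> V (P x)"
      unfolding pS by (intro blinfun.tendsto tendsto_const P_lim)
    show "(\<lambda>n. p (Suc n) x) \<longlonglongrightarrow> P x"
      using P_lim by (rule LIMSEQ_Suc)
  qed
  show thesis
  proof
    show "sym_op P"
      unfolding sym_op_def
    proof (intro allI)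
      fix x y
      have "(\<lambda>n. rinner (p n x) y) \<longlonglongrightarrow> rinner (P x) y"
        "(\<lambda>n. rinner x (p n y)) \<longlonglongrightarrow> rinner x (P y)"
        by (intro rinner.tendsto tendsto_const P_lim)+
      then show "rinner (P x) y = rinner x (P y)"
        using p_sym LIMSEQ_unique by simp
    qed
    have pP: "p n (P x) = P x" for n x
      by (induction n) (simp_all add: p0 pS VP)
    show "P (P x) = P x" for x
      by (rule LIMSEQ_unique[OF P_lim]) (simp add: pP)
    show "G (P x) = 0" for x
      using VP[of x] c by (simp add: V_def op_simps)
    show "P x = x" if "G x = 0" for x
    proof -
      have "p n x = x" for n
        by (induction n) (simp_all add: p0 pS V_def op_simps that)
      then show ?thesis using LIMSEQ_unique[OF P_lim[of x]] by simp
    qed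
    show "commuting C P" if "commuting C G" for C
      unfolding commuting_def
    proof
      fix x
      have CV: "commuting C V" using that by (auto simp: V_def)
      have "(\<lambda>n. C (p n x)) \<longlonglongrightarrow> C (P x)"
        by (intro blinfun.tendsto tendsto_const P_lim)
      moreover have "(\<lambda>n. C (p n x)) \<longlonglongrightarrow> P (C x)"
        using P_lim[of "C x"] commutingD[OF p_comm[OF CV]] by simp
      ultimately show "C (P x) = P (C x)" by (rule LIMSEQ_unique)
    qed
  qed
qed

text \<open>With Z = S - m and W = |Z|, \<open>G = W + Z\<close> is twice the positive part of
  \<open>Z\<close>, and \<open>P\<close> projects onto its kernel. There Z = - W <= 0, while on the
  complement Z = W >= 0.\<close>

lemma spectral_projection_exists:
  fixes S :: "'a::complex_hilbert_space \<Rightarrow>\<^sub>L 'a"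
  assumes S: "sym_op S"
  obtains P where "sym_op P" "\<And>x. P (P x) = P x" "\<And>C. commuting C S \<Longrightarrow> commuting C P"
    "\<And>x. rinner (S (P x)) (P x) \<le> m * (norm (P x))\<^sup>2"
    "\<And>x. m * (norm (x - P x))\<^sup>2 \<le> rinner (S (x - P x)) (x - P x)"
proof -
  define Z where "Z = S - m *\<^sub>R id_blinfun"
  have Z: "sym_op Z" using S by (auto simp: Z_def)
  have "psd_op (Z o\<^sub>L Z)"
    using Z by (auto simp: psd_op_def sym_op_def rinner_self)
  then obtain W where W: "psd_op W" "W o\<^sub>L W = Z o\<^sub>L Z"
    "\<And>C. commuting C (Z o\<^sub>L Z) \<Longrightarrow> commuting C W"
    by (rule psd_op_sqrt_exists) blast
  define G where "G = W + Z"
  have WW: "W (W x) = Z (Z x)" for x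
    using blinfun_compose_eqD[OF W(2), of x] by simp
  have ZW: "Z (W x) = W (Z x)" for x
    by (intro commutingD W) auto
  have G: "sym_op G" using Z psd_opD(1)[OF W(1)] by (auto simp: G_def)
  \<comment> \<open>G^2 has the same kernel as the symmetric \<open>G\<close> and is positive
    semidefinite at once.\<close>
  then have "psd_op (G o\<^sub>L G)"
    by (auto simp: psd_op_def sym_op_def rinner_self)
  then obtain P where P: "sym_op P" "\<And>x. P (P x) = P x" "\<And>x. (G o\<^sub>L G) (P x) = 0"
    "\<And>x. (G o\<^sub>L G) x = 0 \<Longrightarrow> P x = x"
    "\<And>C. commuting C (G o\<^sub>L G) \<Longrightarrow> commuting C P"
    by (rule kernel_projection_exists) blast
  have "rinner (G (P x)) (G (P x)) = 0" for x
    using P(3)[of x] sym_opD[OF G] by simp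
  then have GP: "Z (P x) = - W (P x)" for x
    by (simp add: rinner_self G_def op_simps eq_neg_iff_add_eq_0 add.commute)
  \<comment> \<open>Since G (W - Z) = W^2 - Z^2 = 0, the projection \<open>P\<close> fixes the range
    of \<open>W - Z\<close>.\<close>
  have "(W - Z) (P x) = (W - Z) x" for x
  proof -
    have "commuting (W - Z) (G o\<^sub>L G)"
      by (simp add: commuting_def G_def op_simps WW ZW algebra_simps)
    moreover have "P ((W - Z) x) = (W - Z) x"
      by (rule P(4)) (simp add: G_def op_simps WW ZW algebra_simps)
    ultimately show ?thesis using P(5) commutingD by metis
  qed
  then have FP: "Z (x - P x) = W (x - P x)" for x
    by (simp add: op_simps algebra_simps)
  show thesis
  proof
    show "sym_op P" by fact
    show "P (P x) = P x" for x by fact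
    show "commuting C P" if "commuting C S" for C
    proof -
      have "commuting C Z" using that by (auto simp: Z_def)
      then have "commuting C G" using W(3)[of C] by (auto simp: G_def)
      then show ?thesis using P(5) by auto
    qed
    show "rinner (S (P x)) (P x) \<le> m * (norm (P x))\<^sup>2" for x
      using psd_opD(2)[OF W(1), of "P x"] arg_cong[OF GP[of x], of "\<lambda>z. rinner z (P x)"]
      by (simp add: Z_def op_simps rinner_self)
    show "m * (norm (x - P x))\<^sup>2 \<le> rinner (S (x - P x)) (x - P x)" for x
      using psd_opD(2)[OF W(1), of "x - P x"] arg_cong[OF FP[of x], of "\<lambda>z. rinner z (x - P x)"]
      by (simp add: Z_def blinfun.diff_left blinfun.scaleR_left rinner.diff_left
          rinner.scaleR_left rinner_self)
  qed
qed

section \<open>Comparison of operators and their forms\<close>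

text \<open>Monotonicity of the square root, proved with an approximate eigenvector of \<open>T - G\<close> at the
  bottom of its spectrum.\<close>

lemma rinner_mono_of_norm_mono:
  fixes G T :: "'a::complex_hilbert_space \<Rightarrow>\<^sub>L 'a"
  assumes T: "sym_op T" and G: "sym_op G" and le: "\<And>x. norm (G x) \<le> norm (T x)"
    and "c > 0" and pos: "\<And>x. c * (norm x)\<^sup>2 \<le> rinner (T x + G x) x"
  shows "rinner (G x) x \<le> rinner (T x) x"
proof (rule ccontr)
  assume neg: "\<not> ?thesis"
  define W where "W = T - G"
  define Q where "Q = (\<lambda>y. rinner (W y) y) ` {y. norm y = 1}"
  define i where "i = Inf Q"
  have "- norm W \<le> rinner (W y) y" if "norm y = 1" for y
    using rinner_le_norm_blinfun[of "- W" y] that by (simp add: op_simps)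
  then have bdd: "bdd_below Q" by (auto simp: Q_def bdd_below_def)
  have x: "x \<noteq> 0" "rinner (W x) x < 0" using neg by (auto simp: W_def op_simps)
  have scale: "rinner (W y) y = rinner (W (y /\<^sub>R norm y)) (y /\<^sub>R norm y) * (norm y)\<^sup>2"
    if "y \<noteq> 0" for y
    using that by (simp add: op_simps power2_eq_square field_simps)
  have mem: "rinner (W (y /\<^sub>R norm y)) (y /\<^sub>R norm y) \<in> Q" if "y \<noteq> 0" for y
    using that by (auto simp: Q_def)
  have Q: "Q \<noteq> {}" using mem[OF x(1)] by blast
  have "rinner (W (x /\<^sub>R norm x)) (x /\<^sub>R norm x) < 0"
    using x(2) scale[OF x(1)] by (metis mult_nonneg_nonneg not_le zero_le_power2)
  then have i: "i < 0"
    using cInf_lower[OF mem[OF x(1)] bdd] by (simp add: i_def)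
  have i_le: "i * (norm y)\<^sup>2 \<le> rinner (W y) y" for y
  proof (cases "y = 0")
    case False
    then show ?thesis
      unfolding scale[OF False] i_def
      by (intro mult_right_mono cInf_lower[OF mem[OF False] bdd]) simp
  qed (simp add: op_simps)
  \<comment> \<open>The form of \<open>A\<close> nearly vanishes at an approximate minimiser
    \<open>y\<close>, so \<open>A y\<close> is small and \<open>W y\<close> is close to
    \<open>i y\<close>.\<close>
  define A where "A = W - i *\<^sub>R id_blinfun"
  have A: "psd_op A"
    using T G i_le by (auto simp: psd_op_def A_def W_def op_simps rinner_self)
  define M where "M = norm (T + G)"
  define N where "N = norm A"
  \<comment> \<open>Small enough for M^2 N \<delta> < (i c)^2; the summand 1 makes this strict and
    the denominator positive.\<close>
  define \<delta> where "\<delta> = (i * c)\<^sup>2 / (M\<^sup>2 * N + 1)"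
  have MN: "M\<^sup>2 * N + 1 > 0" by (simp add: N_def add_nonneg_pos)
  have "\<delta> > 0"
    using i \<open>c > 0\<close> MN by (simp add: \<delta>_def)
  then obtain y where y: "norm y = 1" "rinner (W y) y < i + \<delta>"
    using cInf_lessD[OF Q, of "i + \<delta>"] by (auto simp: i_def Q_def)
  have Ay: "(norm (A y))\<^sup>2 \<le> N * \<delta>"
  proof -
    have "(norm (A y))\<^sup>2 \<le> N * rinner (A y) y"
      unfolding N_def by (rule psd_op_norm_sq_le[OF A rinner_le_norm_blinfun])
    also have "\<dots> \<le> N * \<delta>"
      using y by (intro mult_left_mono) (simp_all add: N_def A_def op_simps rinner_self)
    finally show ?thesis .
  qed
  have "0 \<le> (norm (T y))\<^sup>2 - (norm (G y))\<^sup>2"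
    using le[of y] by (simp add: power_mono)
  \<comment> \<open>Replacing \<open>W y\<close> by \<open>i y + A y\<close> in this difference of
    squares leaves a term of at most \<open>i * c < 0\<close> and an error too small to offset
    it.\<close>
  also have "\<dots> = rinner (W y) (T y + G y)"
    by (simp add: W_def op_simps rinner_self[symmetric] rinner_commute)
  also have "\<dots> = i * rinner (T y + G y) y + rinner (A y) (T y + G y)"
    by (simp add: A_def op_simps rinner_commute[of y] algebra_simps)
  also have "\<dots> \<le> i * c + norm (A y) * M"
  proof (rule add_mono)
    show "i * rinner (T y + G y) y \<le> i * c"
      using i pos[of y] y by (intro mult_left_mono_neg) auto
    have "rinner (A y) (T y + G y) \<le> norm (A y) * norm ((T + G) y)"
      using rinner_abs_le[of "A y" "T y + G y"] by (simp add: op_simps)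
    also have "\<dots> \<le> norm (A y) * M"
      using norm_blinfun[of "T + G" y] y by (intro mult_left_mono) (simp_all add: M_def)
    finally show "rinner (A y) (T y + G y) \<le> norm (A y) * M" .
  qed
  finally have "- (i * c) \<le> M * norm (A y)" by (simp add: mult.commute)
  then have "(- (i * c))\<^sup>2 \<le> (M * norm (A y))\<^sup>2"
    using i \<open>c > 0\<close> by (intro power_mono) (simp_all add: mult_nonpos_nonneg)
  also have "\<dots> \<le> M\<^sup>2 * (N * \<delta>)"
    unfolding power_mult_distrib by (intro mult_left_mono Ay) simp
  also have "\<dots> < (M\<^sup>2 * N + 1) * \<delta>"
    using \<open>\<delta> > 0\<close> by (simp add: algebra_simps)
  also have "\<dots> = (i * c)\<^sup>2"
    using MN by (simp add: \<delta>_def)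
  finally show False by simp
qed

text \<open>The upper bound makes F = K X^2 - D positive semidefinite, and the lower bound limits
  its form to 2 K |X x|^2. So |F x| is controlled by |X x|, and D = K X^2 - F. The constant involves
  \<open>X\<close> only through \<open>m\<close>, hence can serve a whole family of
  \<open>X\<close>.\<close>

lemma norm_le_of_quadratic_bound:
  fixes D X :: "'a::complex_hilbert_space \<Rightarrow>\<^sub>L 'a"
  assumes D: "sym_op D" and X: "sym_op X" and "K \<ge> 0"
    and le: "\<And>x. \<bar>rinner (D x) x\<bar> \<le> K * (norm (X x))\<^sup>2" and m: "norm X \<le> m"
  shows "norm (D x) \<le> (K * m + sqrt (2 * K * (K * m\<^sup>2 + norm D))) * norm (X x)"
proof -
  have m0: "0 \<le> m" using m norm_ge_zero order_trans by blast
  define F where "F = K *\<^sub>R (X o\<^sub>L X) - D"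
  define N where "N = K * m\<^sup>2 + norm D"
  have F_form: "rinner (F y) y = K * (norm (X y))\<^sup>2 - rinner (D y) y" for y
    by (simp add: F_def op_simps sym_opD[OF X] rinner_self)
  have "sym_op F" using D X by (auto simp: F_def)
  then have F: "psd_op F"
    using order_trans[OF abs_ge_self le] by (simp add: psd_op_def F_form)
  have "norm F \<le> norm (K *\<^sub>R (X o\<^sub>L X)) + norm D"
    unfolding F_def by (rule norm_triangle_ineq4)
  also have "norm (K *\<^sub>R (X o\<^sub>L X)) \<le> K * (norm X * norm X)"
    using \<open>K \<ge> 0\<close> norm_blinfun_compose[of X X] by (simp add: mult_left_mono)
  also have "\<dots> \<le> K * m\<^sup>2"
    unfolding power2_eq_square using m m0 \<open>K \<ge> 0\<close> by (intro mult_left_mono mult_mono) auto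
  finally have FN: "norm F \<le> N" by (simp add: N_def)
  have "(norm (F x))\<^sup>2 \<le> norm F * rinner (F x) x"
    by (rule psd_op_norm_sq_le[OF F rinner_le_norm_blinfun])
  also have "\<dots> \<le> N * (2 * K * (norm (X x))\<^sup>2)"
    using FN le[of x] psd_opD(2)[OF F] by (intro mult_mono) (auto simp: F_form intro: order_trans[OF norm_ge_zero])
  also have "\<dots> = (sqrt (2 * K * N) * norm (X x))\<^sup>2"
    using \<open>K \<ge> 0\<close> order_trans[OF norm_ge_zero FN] by (simp add: power_mult_distrib)
  finally have Fx: "norm (F x) \<le> sqrt (2 * K * N) * norm (X x)"
    using \<open>K \<ge> 0\<close> order_trans[OF norm_ge_zero FN] by (intro power2_le_imp_le[of "norm (F x)"]) auto
  have "D x = K *\<^sub>R X (X x) - F x" by (simp add: F_def op_simps)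
  then have "norm (D x) \<le> K * norm (X (X x)) + norm (F x)"
    using \<open>K \<ge> 0\<close> by (metis norm_triangle_ineq4 norm_scaleR abs_of_nonneg)
  also have "\<dots> \<le> K * (m * norm (X x)) + sqrt (2 * K * N) * norm (X x)"
    using \<open>K \<ge> 0\<close> by (intro add_mono mult_left_mono Fx order_trans[OF norm_blinfun] mult_right_mono m) auto
  finally show ?thesis by (simp add: N_def algebra_simps)
qed

text \<open>Halving the spectral interval halves the trivial bound, while recombining the two orthogonal
  pieces costs only a factor \<open>sqrt 2\<close>.\<close>

lemma spectral_bisection:
  fixes S D E :: "'a::complex_hilbert_space \<Rightarrow>\<^sub>L 'a"
  assumes S: "sym_op S" and "K \<ge> 0"
  shows "sym_op E \<Longrightarrow> (\<And>x. E (E x) = E x) \<Longrightarrow> commuting E S \<Longrightarrow> a \<le> b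
    \<Longrightarrow> (\<And>x. a * (norm (E x))\<^sup>2 \<le> rinner (S (E x)) (E x))
    \<Longrightarrow> (\<And>x. rinner (S (E x)) (E x) \<le> b * (norm (E x))\<^sup>2)
    \<Longrightarrow> (\<And>u x. a \<le> u \<Longrightarrow> u \<le> b \<Longrightarrow> norm (D x) \<le> K * norm (S x - u *\<^sub>R x))
    \<Longrightarrow> norm (D (E x)) \<le> K * (b - a) * (sqrt 2 / 2) ^ n * norm (E x)"
proof (induction n arbitrary: a b E x)
  case 0
  note E = 0(1-3)
  \<comment> \<open>On the range of \<open>E\<close>, S - a lies between 0 and b - a, so the
    hypothesis at \<open>u = a\<close> gives the bound without bisection.\<close>
  define B where "B = (S - a *\<^sub>R id_blinfun) o\<^sub>L E"
  have "sym_op B"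
    using S E commuting_sym[OF E(3)] unfolding B_def
    by (auto simp: sym_op_def op_simps commutingD[OF E(3)])
  have B_form: "rinner (B y) y = rinner (S (E y)) (E y) - a * (norm (E y))\<^sup>2" for y
  proof -
    have "rinner (B y) y = rinner (E (B y)) y"
      by (simp add: B_def op_simps commutingD[OF E(3)] E(2))
    also have "\<dots> = rinner (B y) (E y)" by (rule sym_opD[OF E(1)])
    finally show ?thesis by (simp add: B_def op_simps rinner_self)
  qed
  have "norm (E y) \<le> norm y" for y
  proof -
    have "rinner (E y) (E y) = rinner (E y) y"
      by (metis E(1,2) sym_opD)
    then have "norm (E y) * norm (E y) \<le> norm (E y) * norm y"
      using rinner_abs_le[of "E y" y] by (simp add: rinner_self power2_eq_square)
    then show ?thesis
      by (cases "E y = 0") auto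
  qed
  then have E_norm: "(norm (E y))\<^sup>2 \<le> (norm y)\<^sup>2" for y
    by (simp add: power_mono)
  have "psd_op B"
    using \<open>sym_op B\<close> 0(5) by (simp add: psd_op_def B_form)
  moreover have "rinner (B y) y \<le> (b - a) * (norm y)\<^sup>2" for y
    using 0(6)[of y] mult_left_mono[OF E_norm[of y], of "b - a"] 0(4)
    by (simp add: B_form algebra_simps)
  ultimately have "norm (B (E x)) \<le> (b - a) * norm (E x)"
    using 0(4) by (intro psd_op_norm_le) auto
  then have "norm (S (E x) - a *\<^sub>R E x) \<le> (b - a) * norm (E x)"
    by (simp add: B_def op_simps E(2))
  then have "K * norm (S (E x) - a *\<^sub>R E x) \<le> K * ((b - a) * norm (E x))"
    using \<open>K \<ge> 0\<close> by (rule mult_left_mono)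
  then show ?case
    using 0(7)[of a "E x"] 0(4) by simp
next
  case (Suc n)
  note E = Suc.prems(1-3)
  define m where "m = (a + b) / 2"
  have m: "a \<le> m" "m \<le> b" using Suc.prems(4) by (simp_all add: m_def)
  obtain P where P: "sym_op P" "\<And>x. P (P x) = P x" "\<And>C. commuting C S \<Longrightarrow> commuting C P"
    "\<And>x. rinner (S (P x)) (P x) \<le> m * (norm (P x))\<^sup>2"
    "\<And>x. m * (norm (x - P x))\<^sup>2 \<le> rinner (S (x - P x)) (x - P x)"
    by (rule spectral_projection_exists[OF S]) blast
  define Q where "Q = id_blinfun - P"
  have Qx: "Q y = y - P y" for y by (simp add: Q_def op_simps)
  have EP: "E (P y) = P (E y)" for y by (intro commutingD P E)
  have SP: "S (P y) = P (S y)" for y by (intro commutingD P) auto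
  have EQ: "E (Q y) = Q (E y)" for y by (simp add: Qx op_simps EP)
  have QQ: "Q (Q y) = Q y" for y by (simp add: Qx op_simps P(2))
  have Q: "sym_op Q" "commuting Q S" "commuting P S"
    using P(1) by (auto simp: Q_def commuting_def op_simps SP)
  \<comment> \<open>The common coefficient for both halves of the interval;
    \<open>L * sqrt 2\<close> is the one claimed for \<open>Suc n\<close>.\<close>
  define L where "L = K * ((b - a) / 2) * (sqrt 2 / 2) ^ n"
  have "L \<ge> 0" using \<open>K \<ge> 0\<close> Suc.prems(4) by (simp add: L_def)
  have PE: "norm (D ((P o\<^sub>L E) x)) \<le> K * (m - a) * (sqrt 2 / 2) ^ n * norm ((P o\<^sub>L E) x)"
  proof (rule Suc.IH)
    show "sym_op (P o\<^sub>L E)"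
      by (rule sym_op_intros(5)) (simp_all add: P(1) E(1) commuting_def EP)
    show "(P o\<^sub>L E) ((P o\<^sub>L E) y) = (P o\<^sub>L E) y" for y by (simp add: EP P(2) E(2))
    show "commuting (P o\<^sub>L E) S"
      by (simp add: commuting_def commutingD[OF E(3)] SP)
    show "a * (norm ((P o\<^sub>L E) y))\<^sup>2 \<le> rinner (S ((P o\<^sub>L E) y)) ((P o\<^sub>L E) y)" for y
      using Suc.prems(5)[of "P y"] by (simp add: EP)
    show "rinner (S ((P o\<^sub>L E) y)) ((P o\<^sub>L E) y) \<le> m * (norm ((P o\<^sub>L E) y))\<^sup>2" for y
      using P(4)[of "E y"] by simp
    show "norm (D y) \<le> K * norm (S y - u *\<^sub>R y)" if "a \<le> u" "u \<le> m" for u y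
      using Suc.prems(7)[of u y] that m by simp
  qed (rule m)
  have QE: "norm (D ((Q o\<^sub>L E) x)) \<le> K * (b - m) * (sqrt 2 / 2) ^ n * norm ((Q o\<^sub>L E) x)"
  proof (rule Suc.IH)
    show "sym_op (Q o\<^sub>L E)"
      by (rule sym_op_intros(5)) (simp_all add: Q(1) E(1) commuting_def EQ)
    show "(Q o\<^sub>L E) ((Q o\<^sub>L E) y) = (Q o\<^sub>L E) y" for y by (simp add: EQ QQ E(2))
    show "commuting (Q o\<^sub>L E) S"
      by (simp add: commuting_def commutingD[OF E(3)] commutingD[OF Q(2)])
    show "m * (norm ((Q o\<^sub>L E) y))\<^sup>2 \<le> rinner (S ((Q o\<^sub>L E) y)) ((Q o\<^sub>L E) y)" for y
      using P(5)[of "E y"] by (simp add: Qx)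
    show "rinner (S ((Q o\<^sub>L E) y)) ((Q o\<^sub>L E) y) \<le> b * (norm ((Q o\<^sub>L E) y))\<^sup>2" for y
      using Suc.prems(6)[of "Q y"] by (simp add: EQ)
    show "norm (D y) \<le> K * norm (S y - u *\<^sub>R y)" if "m \<le> u" "u \<le> b" for u y
      using Suc.prems(7)[of u y] that m by simp
  qed (rule m)
  have "rinner (P y) (P y) = rinner (P y) y" for y
    by (metis P(1,2) sym_opD)
  then have pythagoras: "(norm (P (E x)))\<^sup>2 + (norm (Q (E x)))\<^sup>2 = (norm (E x))\<^sup>2"
    by (simp add: Qx rinner_self[symmetric] op_simps rinner_commute[of "E x" "P (E x)"])
  have "(norm (P (E x)) + norm (Q (E x)))\<^sup>2 \<le> 2 * ((norm (P (E x)))\<^sup>2 + (norm (Q (E x)))\<^sup>2)"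
    using zero_le_power2[of "norm (P (E x)) - norm (Q (E x))"]
    by (simp add: power2_eq_square algebra_simps)
  also have "\<dots> = (sqrt 2 * norm (E x))\<^sup>2"
    by (simp add: pythagoras power_mult_distrib)
  finally have sum_le: "norm (P (E x)) + norm (Q (E x)) \<le> sqrt 2 * norm (E x)"
    by (rule power2_le_imp_le) simp
  have "D (E x) = D (P (E x)) + D (Q (E x))"
    by (simp add: Qx op_simps)
  then have "norm (D (E x)) \<le> norm (D (P (E x))) + norm (D (Q (E x)))"
    by (simp add: norm_triangle_ineq)
  also have "\<dots> \<le> L * (norm (P (E x)) + norm (Q (E x)))"
    using PE QE by (simp add: L_def m_def field_simps)
  also have "\<dots> \<le> L * (sqrt 2 * norm (E x))"
    using sum_le \<open>L \<ge> 0\<close> by (rule mult_left_mono)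
  finally show ?case by (simp add: L_def algebra_simps)
qed

section \<open>Mutual form bounds\<close>

text \<open>With \<open>D = T - S\<close> and \<open>X = S - u\<close>, the first form bound reads \<open>2 u D \<le> X\<^sup>2\<close>. The second one
  gives \<open>T \<ge> R\<close> for the square root \<open>R\<close> of \<open>u (2 S - u)\<close>, which is a positive operator because
  \<open>u \<le> 2 s\<close>; since \<open>S\<^sup>2 - R\<^sup>2 = X\<^sup>2\<close>, also \<open>- D \<le> S - R \<le> X\<^sup>2 / s\<close>.\<close>

lemma quadratic_contact:
  fixes S T :: "'a::complex_hilbert_space \<Rightarrow>\<^sub>L 'a"
  assumes S: "sym_op S" and T: "psd_op T" and "s > 0"
    and lower: "\<And>x. s * (norm x)\<^sup>2 \<le> rinner (S x) x"
    and TS: "\<And>u x. u > 0 \<Longrightarrow> 2 * u * rinner (T x) x \<le> (norm (S x))\<^sup>2 + u\<^sup>2 * (norm x)\<^sup>2"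
    and ST: "\<And>u x. u > 0 \<Longrightarrow> 2 * u * rinner (S x) x \<le> (norm (T x))\<^sup>2 + u\<^sup>2 * (norm x)\<^sup>2"
    and u: "s \<le> u" "u \<le> 2 * s"
  shows "\<bar>rinner (T x - S x) x\<bar> \<le> (1 / s) * (norm (S x - u *\<^sub>R x))\<^sup>2"
proof -
  have "u > 0" using u \<open>s > 0\<close> by simp
  define X where "X = S - u *\<^sub>R id_blinfun"
  have X: "sym_op X" using S by (auto simp: X_def)
  have X_sq: "(norm (X y))\<^sup>2 = (norm (S y))\<^sup>2 - 2 * u * rinner (S y) y + u\<^sup>2 * (norm y)\<^sup>2" for y
    by (simp add: X_def op_simps rinner_self[symmetric] rinner_commute[of y "S y"])
       (simp add: power2_eq_square algebra_simps)
  define B where "B = u *\<^sub>R (2 *\<^sub>R S - u *\<^sub>R id_blinfun)"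
  have B_form: "rinner (B y) y = 2 * u * rinner (S y) y - u\<^sup>2 * (norm y)\<^sup>2" for y
    by (simp add: B_def op_simps rinner_self power2_eq_square algebra_simps)
  \<comment> \<open>Nonnegativity comes from 2 S >= 2 s >= u.\<close>
  have "0 \<le> u * (2 * rinner (S y) y - u * (norm y)\<^sup>2)" for y
    using \<open>u > 0\<close> lower[of y] mult_right_mono[OF u(2), of "(norm y)\<^sup>2"]
    by (intro mult_nonneg_nonneg) auto
  then have "0 \<le> rinner (B y) y" for y
    by (simp add: B_form power2_eq_square algebra_simps)
  moreover have "sym_op B" using S by (auto simp: B_def)
  ultimately have "psd_op B" by (simp add: psd_op_def)
  then obtain R where R: "psd_op R" "R o\<^sub>L R = B" "\<And>C. commuting C B \<Longrightarrow> commuting C R"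
    by (rule psd_op_sqrt_exists) blast
  have RR: "R (R y) = B y" for y by (rule blinfun_compose_eqD[OF R(2)])
  have R_sq: "(norm (R y))\<^sup>2 = 2 * u * rinner (S y) y - u\<^sup>2 * (norm y)\<^sup>2" for y
    using sym_opD[OF psd_opD(1)[OF R(1)], of "R y" y]
    by (simp add: RR B_form rinner_self)
  have "commuting S B" by (auto simp: B_def)
  then have SR: "S (R y) = R (S y)" for y by (intro commutingD R)
  have RT: "rinner (R y) y \<le> rinner (T y) y" for y
  proof (rule rinner_mono_of_norm_mono)
    show "sym_op T" "sym_op R" using T R psd_opD by blast+
    show "norm (R z) \<le> norm (T z)" for z
      using ST[OF \<open>u > 0\<close>, of z] R_sq[of z] by (intro power2_le_imp_le[of "norm (R z)"]) auto
    \<comment> \<open>\<open>ST\<close> at \<open>s\<close> together with S >= s gives |T z| >= s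
      |z|, hence T >= s, the strictly positive lower bound required for T + R.\<close>
    have "norm (s *\<^sub>R z) \<le> norm (T z)" for z
    proof (rule power2_le_imp_le)
      have "2 * s * (s * (norm z)\<^sup>2) \<le> 2 * s * rinner (S z) z"
        using lower[of z] \<open>s > 0\<close> by (intro mult_left_mono) auto
      moreover have "s\<^sup>2 * (norm z)\<^sup>2 = s * (s * (norm z)\<^sup>2)"
        by (simp add: power2_eq_square)
      moreover have "(norm (s *\<^sub>R z))\<^sup>2 = s * (s * (norm z)\<^sup>2)"
        using \<open>s > 0\<close> by (simp add: power_mult_distrib power2_eq_square)
      ultimately show "(norm (s *\<^sub>R z))\<^sup>2 \<le> (norm (T z))\<^sup>2"
        using ST[OF \<open>s > 0\<close>, of z] by linarith
    qed simp
    then have "rinner ((s *\<^sub>R id_blinfun) z) z \<le> rinner (T z) z" for z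
      using \<open>s > 0\<close> T psd_opD(2)[OF T]
      by (intro rinner_mono_of_norm_mono[where c = s])
         (auto simp: op_simps rinner_self psd_op_def)
    then show "s * (norm z)\<^sup>2 \<le> rinner (T z + R z) z" for z
      using psd_opD(2)[OF R(1), of z] by (simp add: op_simps rinner_self add_increasing2)
  qed (rule \<open>s > 0\<close>)
  have RS: "rinner (R y) y \<le> rinner (S y) y" for y
  proof (rule rinner_mono_of_norm_mono)
    show "sym_op S" "sym_op R" using S R psd_opD by blast+
    show "norm (R z) \<le> norm (S z)" for z
      using zero_le_power2[of "norm (X z)"] X_sq[of z] R_sq[of z]
      by (intro power2_le_imp_le[of "norm (R z)"]) auto
    show "s * (norm z)\<^sup>2 \<le> rinner (S z + R z) z" for z
      using psd_opD(2)[OF R(1), of z] lower[of z] by (simp add: op_simps)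
  qed (rule \<open>s > 0\<close>)
  define W where "W = S - R"
  have "sym_op W" using S psd_opD(1)[OF R(1)] by (auto simp: W_def)
  then have "psd_op W" by (simp add: psd_op_def W_def op_simps RS)
  \<comment> \<open>The root \<open>V\<close> of W = S - R commutes with \<open>S\<close> and
    \<open>R\<close>, so s W = s V^2 <= V (S + R) V = S^2 - R^2 = X^2.\<close>
  then obtain V where V: "psd_op V" "V o\<^sub>L V = W" "\<And>C. commuting C W \<Longrightarrow> commuting C V"
    by (rule psd_op_sqrt_exists) blast
  have VV: "V (V y) = S y - R y" for y
    using blinfun_compose_eqD[OF V(2)] by (simp add: W_def op_simps)
  have "commuting S W" "commuting R W"
    by (auto simp: W_def commuting_def op_simps SR)
  then have SV: "S (V y) = V (S y)" and RV: "R (V y) = V (R y)" for y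
    by (auto intro: commutingD V)
  have V_sym: "rinner (V y) z = rinner y (V z)" for y z
    by (rule sym_opD[OF psd_opD(1)[OF V(1)]])
  have "s * rinner (W x) x = s * (norm (V x))\<^sup>2"
    by (simp add: rinner_self[symmetric] V_sym[symmetric] VV W_def op_simps)
  also have "\<dots> \<le> rinner (S (V x) + R (V x)) (V x)"
    using lower[of "V x"] psd_opD(2)[OF R(1), of "V x"] by (simp add: op_simps)
  also have "\<dots> = rinner (S (S x) - R (R x)) x"
    by (simp add: SV RV op_simps V_sym[symmetric] VV SR)
  also have "\<dots> = (norm (X x))\<^sup>2"
    by (simp add: RR B_form X_sq rinner.diff_left rinner_self sym_opD[OF S, of "S x" x])
  finally have "rinner (S x) x - rinner (R x) x \<le> (1 / s) * (norm (X x))\<^sup>2"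
    using \<open>s > 0\<close> by (simp add: W_def op_simps field_simps)
  then have "- rinner (T x - S x) x \<le> (1 / s) * (norm (X x))\<^sup>2"
    using RT[of x] by (simp add: op_simps)
  moreover have "rinner (T x - S x) x \<le> (1 / s) * (norm (X x))\<^sup>2"
  proof -
    have "2 * u * rinner (T x - S x) x \<le> (norm (X x))\<^sup>2"
      using TS[OF \<open>u > 0\<close>, of x] by (simp add: X_sq op_simps algebra_simps)
    then have "rinner (T x - S x) x \<le> (1 / (2 * u)) * (norm (X x))\<^sup>2"
      using \<open>u > 0\<close> by (simp add: field_simps)
    also have "\<dots> \<le> (1 / s) * (norm (X x))\<^sup>2"
      using u \<open>s > 0\<close> by (intro mult_right_mono frac_le) auto
    finally show ?thesis .
  qed
  ultimately show ?thesis by (simp add: X_def op_simps)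
qed

text \<open>The contact bound yields |D y| <= K |(S - u) y| with one \<open>K\<close> for all u in
  [s, 2 s]. Bisection then applies for every \<open>n\<close>, and its factor (sqrt 2 / 2)^n tends
  to 0.\<close>

lemma eq_on_lower_spectral_part:
  fixes S T P :: "'a::complex_hilbert_space \<Rightarrow>\<^sub>L 'a"
  assumes S: "sym_op S" and T: "psd_op T" and "s > 0"
    and lower: "\<And>x. s * (norm x)\<^sup>2 \<le> rinner (S x) x"
    and TS: "\<And>u x. u > 0 \<Longrightarrow> 2 * u * rinner (T x) x \<le> (norm (S x))\<^sup>2 + u\<^sup>2 * (norm x)\<^sup>2"
    and ST: "\<And>u x. u > 0 \<Longrightarrow> 2 * u * rinner (S x) x \<le> (norm (T x))\<^sup>2 + u\<^sup>2 * (norm x)\<^sup>2"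
    and P: "sym_op P" "\<And>x. P (P x) = P x" "commuting P S"
    and upper: "\<And>x. rinner (S (P x)) (P x) \<le> 2 * s * (norm (P x))\<^sup>2"
  shows "T (P x) = S (P x)"
proof -
  define D where "D = T - S"
  \<comment> \<open>Bounds the norm of S - u for all u in [s, 2 s], which makes \<open>K\<close>
    independent of \<open>u\<close>.\<close>
  define m where "m = norm S + 2 * s"
  define K where "K = (1 / s) * m + sqrt (2 * (1 / s) * ((1 / s) * m\<^sup>2 + norm D))"
  have D: "sym_op D" using S T by (auto simp: D_def psd_op_def)
  have "m \<ge> 0" using \<open>s > 0\<close> by (simp add: m_def)
  then have K: "K \<ge> 0" using \<open>s > 0\<close> by (simp add: K_def)
  have bound: "norm (D y) \<le> K * norm (S y - u *\<^sub>R y)" if u: "s \<le> u" "u \<le> 2 * s" for u y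
  proof -
    define X where "X = S - u *\<^sub>R (id_blinfun :: 'a \<Rightarrow>\<^sub>L 'a)"
    have Xy: "X z = S z - u *\<^sub>R z" for z by (simp add: X_def op_simps)
    have "norm X \<le> norm S + norm (u *\<^sub>R (id_blinfun :: 'a \<Rightarrow>\<^sub>L 'a))"
      unfolding X_def by (rule norm_triangle_ineq4)
    also have "norm (u *\<^sub>R (id_blinfun :: 'a \<Rightarrow>\<^sub>L 'a)) \<le> 2 * s"
      using u \<open>s > 0\<close> by (intro norm_blinfun_bound) (auto simp: op_simps intro: mult_right_mono)
    finally have "norm X \<le> m" by (simp add: m_def)
    moreover have "\<bar>rinner (D z) z\<bar> \<le> (1 / s) * (norm (X z))\<^sup>2" for z
      using quadratic_contact[OF S T \<open>s > 0\<close> lower TS ST u, of z]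
      by (simp add: Xy D_def op_simps)
    moreover have "sym_op X" using S by (auto simp: X_def)
    ultimately have "norm (D y) \<le> K * norm (X y)"
      using \<open>s > 0\<close> unfolding K_def by (intro norm_le_of_quadratic_bound D) auto
    then show ?thesis by (simp add: Xy)
  qed
  have "norm (D (P x)) \<le> K * (2 * s - s) * (sqrt 2 / 2) ^ n * norm (P x)" for n
    by (rule spectral_bisection[OF S K P])
       (use \<open>s > 0\<close> lower upper bound in auto)
  moreover have "(\<lambda>n. K * (2 * s - s) * (sqrt 2 / 2) ^ n * norm (P x)) \<longlonglongrightarrow> K * (2 * s - s) * 0 * norm (P x)"
    by (intro tendsto_intros LIMSEQ_power_zero) (simp add: sqrt2_less_2)
  ultimately have "norm (D (P x)) \<le> 0"
    using LIMSEQ_le_const[of _ "K * (2 * s - s) * 0 * norm (P x)" "norm (D (P x))"] by auto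
  then show ?thesis by (simp add: D_def op_simps)
qed

text \<open>The induction step replaces \<open>S\<close> and \<open>T\<close> by \<open>2 s\<close> on the spectral subspace where they are already
  known to agree, which doubles the lower bound and keeps all hypotheses.\<close>

lemma eq_of_mutual_form_bounds:
  fixes S T :: "'a::complex_hilbert_space \<Rightarrow>\<^sub>L 'a"
  shows "sym_op S \<Longrightarrow> psd_op T \<Longrightarrow> s > 0
    \<Longrightarrow> (\<And>x. s * (norm x)\<^sup>2 \<le> rinner (S x) x)
    \<Longrightarrow> (\<And>x. rinner (S x) x \<le> s * 2 ^ k * (norm x)\<^sup>2)
    \<Longrightarrow> (\<And>u x. u > 0 \<Longrightarrow> 2 * u * rinner (T x) x \<le> (norm (S x))\<^sup>2 + u\<^sup>2 * (norm x)\<^sup>2)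
    \<Longrightarrow> (\<And>u x. u > 0 \<Longrightarrow> 2 * u * rinner (S x) x \<le> (norm (T x))\<^sup>2 + u\<^sup>2 * (norm x)\<^sup>2)
    \<Longrightarrow> S = T"
proof (induction k arbitrary: S T s)
  case 0
  \<comment> \<open>For \<open>k = 0\<close> the form of \<open>S\<close> stays below
    \<open>2 * s\<close> everywhere, so the identity serves as the projection.\<close>
  have "T (id_blinfun x) = S (id_blinfun x)" for x
  proof (rule eq_on_lower_spectral_part[OF 0(1-4,6,7)])
    show "rinner (S (id_blinfun y)) (id_blinfun y) \<le> 2 * s * (norm (id_blinfun y))\<^sup>2" for y
      using 0(3) 0(5)[of y] zero_le_power2[of "norm y"] by (simp add: order_trans)
  qed (auto simp: commuting_def)
  then show ?case by (intro blinfun_eqI) simp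
next
  case (Suc k)
  note S = Suc.prems(1) and T = Suc.prems(2) and s = Suc.prems(3)
  obtain P where P: "sym_op P" "\<And>x. P (P x) = P x" "\<And>C. commuting C S \<Longrightarrow> commuting C P"
    "\<And>x. rinner (S (P x)) (P x) \<le> 2 * s * (norm (P x))\<^sup>2"
    "\<And>x. 2 * s * (norm (x - P x))\<^sup>2 \<le> rinner (S (x - P x)) (x - P x)"
    by (rule spectral_projection_exists[OF S]) blast
  have "commuting S P" by (intro P) auto
  then have PS: "commuting P S" and SP: "S (P x) = P (S x)" for x
    by (auto intro: commuting_sym commutingD)
  have TP: "T (P x) = S (P x)" for x
    by (rule eq_on_lower_spectral_part[OF Suc.prems(1-4,6,7) P(1,2) PS P(4)])
  \<comment> \<open>T P = S P is symmetric because \<open>S\<close> and \<open>P\<close> commute,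
    and symmetry of T P means P T = T P.\<close>
  have PT: "P (T x) = T (P x)" for x
  proof -
    have "rinner (P (T x) - T (P x)) y = 0" for y
      by (simp add: op_simps sym_opD[OF P(1)] sym_opD[OF S] sym_opD[OF psd_opD(1)[OF T]] TP SP)
    then show ?thesis
      by (metis rinner_self norm_eq_zero power_eq_0_iff right_minus_eq)
  qed
  define Q where "Q = id_blinfun - P"
  have Qx: "Q x = x - P x" for x by (simp add: Q_def op_simps)
  have Q: "sym_op Q" using P(1) by (auto simp: Q_def)
  have ortho: "rinner (P x) (Q y) = 0" for x y
    by (simp add: sym_opD[OF P(1)] Qx op_simps P(2))
  have pythagoras: "(norm x)\<^sup>2 = (norm (Q x))\<^sup>2 + (norm (P x))\<^sup>2" for x
  proof -
    have "(norm (Q x + P x))\<^sup>2 = (norm (Q x))\<^sup>2 + (norm (P x))\<^sup>2"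
      by (simp only: rinner_self[symmetric] op_simps ortho rinner_commute[of "Q x" "P x"])
    then show ?thesis by (simp add: Qx)
  qed
  \<comment> \<open>The new operator is \<open>F\<close> on the range of \<open>Q\<close> and
    \<open>2 * s\<close> on that of \<open>P\<close>; forms and squared norms split
    orthogonally.\<close>
  have compress: "sym_op ((F o\<^sub>L Q) + (2 * s) *\<^sub>R P)"
    "rinner (((F o\<^sub>L Q) + (2 * s) *\<^sub>R P) x) x = rinner (F (Q x)) (Q x) + 2 * s * (norm (P x))\<^sup>2"
    "(norm (((F o\<^sub>L Q) + (2 * s) *\<^sub>R P) x))\<^sup>2 = (norm (F (Q x)))\<^sup>2 + (2 * s)\<^sup>2 * (norm (P x))\<^sup>2"
    if F: "sym_op F" "\<And>x. P (F x) = F (P x)" for F x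
  proof -
    have FQ: "F (Q x) = Q (F x)" for x by (simp add: Qx op_simps F(2))
    then have "commuting F Q" by (simp add: commuting_def)
    then show "sym_op ((F o\<^sub>L Q) + (2 * s) *\<^sub>R P)" using F(1) Q P(1) by auto
    have PF: "rinner (P y) (F (Q x)) = 0" for y x by (simp add: FQ ortho)
    have "rinner (F (Q x)) x = rinner (F (Q x)) (Q x + P x)"
      by (simp add: Qx)
    also have "\<dots> = rinner (F (Q x)) (Q x)"
      by (simp only: rinner.add_right rinner_commute[of "F (Q x)" "P x"] PF)
    finally have 1: "rinner (F (Q x)) x = rinner (F (Q x)) (Q x)" .
    have 2: "rinner (P x) x = (norm (P x))\<^sup>2"
      by (metis P(1,2) sym_opD rinner_self)
    show "rinner (((F o\<^sub>L Q) + (2 * s) *\<^sub>R P) x) x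
        = rinner (F (Q x)) (Q x) + 2 * s * (norm (P x))\<^sup>2"
      by (simp add: blinfun.add_left blinfun.scaleR_left rinner.add_left rinner.scaleR_left 1 2)
    show "(norm (((F o\<^sub>L Q) + (2 * s) *\<^sub>R P) x))\<^sup>2 = (norm (F (Q x)))\<^sup>2 + (2 * s)\<^sup>2 * (norm (P x))\<^sup>2"
      by (simp add: rinner_self[symmetric] blinfun.add_left blinfun.scaleR_left rinner.add_left
          rinner.add_right rinner.scaleR_left rinner.scaleR_right PF
          rinner_commute[of "F (Q x)" "P x"]) (simp add: power2_eq_square)
  qed
  define S' where "S' = (S o\<^sub>L Q) + (2 * s) *\<^sub>R P"
  define T' where "T' = (T o\<^sub>L Q) + (2 * s) *\<^sub>R P"
  note S' = compress[OF S SP[symmetric], folded S'_def]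
  note T' = compress[OF psd_opD(1)[OF T] PT, folded T'_def]
  \<comment> \<open>On the range of \<open>P\<close> both new operators are \<open>2 * s\<close>,
    and each form bound becomes (2 s - u)^2 >= 0.\<close>
  have square: "2 * u * (2 * s * (norm (P x))\<^sup>2) \<le> (2 * s)\<^sup>2 * (norm (P x))\<^sup>2 + u\<^sup>2 * (norm (P x))\<^sup>2" for u x
    using mult_right_mono[OF zero_le_power2[of "2 * s - u"] zero_le_power2[of "norm (P x)"]]
    by (simp add: power2_eq_square algebra_simps)
  have "S' = T'"
  proof (rule Suc.IH)
    show "sym_op S'" by (rule S')
    show "psd_op T'"
      using T'(1) psd_opD(2)[OF T] s by (simp add: psd_op_def T'(2))
    show "2 * s > 0" using s by simp
    show "2 * s * (norm x)\<^sup>2 \<le> rinner (S' x) x" for x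
      using P(5)[of x] by (simp add: S'(2) pythagoras[of x] Qx algebra_simps)
    \<comment> \<open>The upper bound is unchanged: doubling \<open>s\<close> compensates for the
      smaller exponent.\<close>
    show "rinner (S' x) x \<le> 2 * s * 2 ^ k * (norm x)\<^sup>2" for x
    proof -
      have "2 * s * (norm (P x))\<^sup>2 * 1 \<le> 2 * s * (norm (P x))\<^sup>2 * 2 ^ k"
        using s by (intro mult_left_mono) auto
      then show ?thesis
        using Suc.prems(5)[of "Q x"] by (simp add: S'(2) pythagoras[of x] algebra_simps)
    qed
    show "2 * u * rinner (T' x) x \<le> (norm (S' x))\<^sup>2 + u\<^sup>2 * (norm x)\<^sup>2" if "u > 0" for u x
      using Suc.prems(6)[OF that, of "Q x"] square[of u x]
      unfolding S' T' pythagoras[of x] distrib_left by linarith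
    show "2 * u * rinner (S' x) x \<le> (norm (T' x))\<^sup>2 + u\<^sup>2 * (norm x)\<^sup>2" if "u > 0" for u x
      using Suc.prems(7)[OF that, of "Q x"] square[of u x]
      unfolding S' T' pythagoras[of x] distrib_left by linarith
  qed
  then have "S o\<^sub>L Q = T o\<^sub>L Q" by (simp add: S'_def T'_def)
  then have SQ: "S (Q x) = T (Q x)" for x by (metis blinfun_apply_blinfun_compose)
  show "S = T"
  proof (rule blinfun_eqI)
    fix x
    have "S (Q x + P x) = T (Q x + P x)"
      by (simp only: blinfun.add_right SQ TP)
    then show "S x = T x" by (simp add: Qx)
  qed
qed

section \<open>Square roots of positive operators\<close>

lemma scaleC_i_i: "\<i> *\<^sub>C \<i> *\<^sub>C x = - (x :: 'a::complex_hilbert_space)"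
proof -
  have "\<i> *\<^sub>C \<i> *\<^sub>C x = complex_of_real (- 1) *\<^sub>C x"
    by (simp only: scaleC_scaleC) simp
  also have "\<dots> = (- 1) *\<^sub>R x"
    by (simp only: scaleR_eq_scaleC)
  finally show ?thesis by simp
qed

lemma rinner_scaleC_i_right: "rinner x (\<i> *\<^sub>C y) = - rinner (\<i> *\<^sub>C x) y"
  by (simp add: rinner_def cinner_scaleC_left cinner_commute[of x])

text \<open>Makes complex scalars bounded real-linear maps, so that complex linearity becomes
  commutation with them.\<close>

lemma bounded_linear_scaleC: "bounded_linear (\<lambda>x::'a::complex_hilbert_space. c *\<^sub>C x)"
proof (rule bounded_linear_intro[where K = "cmod c"])
  fix x y :: 'a and r :: real
  show "c *\<^sub>C (x + y) = c *\<^sub>C x + c *\<^sub>C y" by (rule scaleC_add_right)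
  show "c *\<^sub>C r *\<^sub>R x = r *\<^sub>R c *\<^sub>C x"
    by (simp add: scaleR_eq_scaleC scaleC_scaleC mult.commute)
  have "cinner (c *\<^sub>C x) (c *\<^sub>C x) = c * cnj c * cinner x x"
    by (simp add: cinner_scaleC_left cinner_commute[of x "c *\<^sub>C x"] mult.assoc)
       (metis cinner_commute)
  also have "\<dots> = of_real ((cmod c)\<^sup>2) * cinner x x"
    by (simp only: complex_norm_square)
  finally have "(norm (c *\<^sub>C x))\<^sup>2 = (cmod c)\<^sup>2 * (norm x)\<^sup>2"
    by (simp add: rinner_self[symmetric] rinner_def)
  then show "norm (c *\<^sub>C x) \<le> norm x * cmod c"
    by (intro power2_le_imp_le[of "norm (c *\<^sub>C x)"]) (simp_all add: power_mult_distrib mult.commute)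
qed

text \<open>A real form means Re <i A z, z> = 0 for all z. At z = x + i y the pure terms vanish, and
  the cross terms give symmetry.\<close>

lemma positive_op_imp_psd_op:
  assumes "positive_op A"
  shows "psd_op (Blinfun A)" "blinfun_apply (Blinfun A) = A"
proof -
  have lin: "bounded_linear A" and C: "\<And>c x. A (c *\<^sub>C x) = c *\<^sub>C A x"
    and real: "\<And>x. cinner (A x) x \<in> \<real>\<^sub>\<ge>\<^sub>0"
    using assms by (auto simp: positive_op_def bounded_clinear_def)
  interpret A: bounded_linear A by (rule lin)
  show ap: "blinfun_apply (Blinfun A) = A" by (rule bounded_linear_Blinfun_apply[OF lin])
  have real': "rinner (\<i> *\<^sub>C A x) x = 0" for x
    using real[of x] by (simp add: rinner_def cinner_scaleC_left complex_nonneg_Reals_iff)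
  have "rinner (A x) y = rinner x (A y)" for x y
  proof -
    have i_add: "\<i> *\<^sub>C (u + v) = \<i> *\<^sub>C u + \<i> *\<^sub>C v" for u v :: 'a by (rule scaleC_add_right)
    have "0 = rinner (\<i> *\<^sub>C A (x + \<i> *\<^sub>C y)) (x + \<i> *\<^sub>C y)"
      by (simp only: real')
    also have "\<dots> = rinner (\<i> *\<^sub>C A x) x + rinner (\<i> *\<^sub>C A x) (\<i> *\<^sub>C y)
        + (rinner (\<i> *\<^sub>C \<i> *\<^sub>C A y) x + rinner (\<i> *\<^sub>C A (\<i> *\<^sub>C y)) (\<i> *\<^sub>C y))"
      by (simp add: A.add C i_add rinner_add_left rinner_add_right)
    also have "\<dots> = rinner (\<i> *\<^sub>C A x) (\<i> *\<^sub>C y) + rinner (\<i> *\<^sub>C \<i> *\<^sub>C A y) x"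
      by (simp only: real' add_0 add_0_right)
    also have "\<dots> = rinner (A x) y - rinner (A y) x"
      by (simp add: rinner_scaleC_i_right scaleC_i_i rinner.minus_left)
    finally show ?thesis by (simp add: rinner_commute)
  qed
  then show "psd_op (Blinfun A)"
    using real by (auto simp: psd_op_def sym_op_def ap rinner_def complex_nonneg_Reals_iff)
qed

text \<open>Semidefiniteness controls only the real part of the form; symmetry at the pair i x, x
  with complex linearity removes the imaginary part.\<close>

lemma psd_op_imp_positive_op:
  fixes R :: "'a::complex_hilbert_space \<Rightarrow>\<^sub>L 'a"
  assumes R: "psd_op R" and C: "\<And>c x. R (c *\<^sub>C x) = c *\<^sub>C R x"
  shows "positive_op R"
proof -
  have "Im (cinner (R x) x) = 0" for x
  proof -
    have "rinner (R (\<i> *\<^sub>C x)) x = rinner (\<i> *\<^sub>C x) (R x)"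
      by (rule sym_opD[OF psd_opD(1)[OF R]])
    then have "- Im (cinner (R x) x) = - Im (cinner x (R x))"
      by (simp add: C rinner_def cinner_scaleC_left)
    also have "Im (cinner x (R x)) = - Im (cinner (R x) x)"
      by (subst cinner_commute) simp
    finally show ?thesis by simp
  qed
  then have "cinner (R x) x \<in> \<real>\<^sub>\<ge>\<^sub>0" for x
    using psd_opD(2)[OF R, of x] by (simp add: rinner_def complex_nonneg_Reals_iff)
  then show ?thesis
    using C by (simp add: positive_op_def bounded_clinear_def blinfun.bounded_linear_right)
qed

text \<open>The real-linear root commutes with complex scalars because \<open>A\<close> does, so it
  meets the description of \<open>sqrt_op\<close>; uniqueness among real-linear roots makes it the
  only candidate.\<close>

lemma sqrt_op_blinfun:
  fixes A :: "'a::complex_hilbert_space \<Rightarrow> 'a"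
  assumes A: "positive_op A"
  obtains R :: "'a \<Rightarrow>\<^sub>L 'a" where "psd_op R" "sqrt_op A = blinfun_apply R" "\<And>x. R (R x) = A x"
proof -
  note A' = positive_op_imp_psd_op[OF A]
  obtain R where R: "psd_op R" "R o\<^sub>L R = Blinfun A"
    "\<And>C. commuting C (Blinfun A) \<Longrightarrow> commuting C R"
    by (rule psd_op_sqrt_exists[OF A'(1)]) blast
  have RR: "R (R x) = A x" for x
    using blinfun_compose_eqD[OF R(2), of x] by (simp add: A'(2))
  have "R (c *\<^sub>C x) = c *\<^sub>C R x" for c x
  proof -
    have Mc: "blinfun_apply (Blinfun (\<lambda>x::'a. c *\<^sub>C x)) = (\<lambda>x. c *\<^sub>C x)"
      by (rule bounded_linear_Blinfun_apply[OF bounded_linear_scaleC])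
    have comm: "commuting (Blinfun (\<lambda>x::'a. c *\<^sub>C x)) (Blinfun A)"
      using A by (simp add: commuting_def Mc A'(2) positive_op_def bounded_clinear_def)
    then show ?thesis
      using commutingD[OF R(3)[OF comm], of x] by (simp add: Mc)
  qed
  then have pos: "positive_op R" by (rule psd_op_imp_positive_op[OF R(1)])
  have "sqrt_op A = blinfun_apply R"
    unfolding sqrt_op_def
  proof (rule the_equality)
    show "positive_op R \<and> blinfun_apply R \<circ> blinfun_apply R = A"
      using pos RR by auto
    fix S assume S: "positive_op S \<and> S \<circ> S = A"
    note S' = positive_op_imp_psd_op[OF conjunct1[OF S]]
    have "S (S x) = A x" for x using S by (metis comp_apply)
    then have "Blinfun S o\<^sub>L Blinfun S = R o\<^sub>L R"
      by (intro blinfun_eqI) (simp add: S'(2) RR)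
    then have "Blinfun S = R" by (rule psd_op_sqrt_unique[OF S'(1) R(1)])
    then show "S = blinfun_apply R" using S'(2) by simp
  qed
  then show thesis using that R(1) RR by blast
qed

text \<open>By homogeneity and <B y, y> = |T y|^2, the relation reads <R x, x> <= |T x| |x|. The
  arithmetic-geometric mean inequality with weight \<open>u\<close> makes the right side
  quadratic.\<close>

lemma root_quad_leD:
  fixes R T :: "'a::complex_hilbert_space \<Rightarrow>\<^sub>L 'a"
  assumes "A \<unlhd> B" and R: "sqrt_op A = blinfun_apply R" and T: "sym_op T" "\<And>x. T (T x) = B x"
    and "u > 0"
  shows "2 * u * rinner (R x) x \<le> (norm (T x))\<^sup>2 + u\<^sup>2 * (norm x)\<^sup>2"
proof (cases "x = 0")
  case False
  have T_sq: "rinner (B y) y = (norm (T y))\<^sup>2" for y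
    by (simp add: T(2)[symmetric] sym_opD[OF T(1)] rinner_self)
  define r where "r = norm x"
  define y where "y = x /\<^sub>R r"
  have y: "norm y = 1" "x = r *\<^sub>R y" using False by (simp_all add: y_def r_def)
  have "rinner (R y) y \<le> sqrt (rinner (B y) y)"
    using assms(1) y(1) unfolding root_quad_le_def R rinner_def by blast
  then have "rinner (R y) y \<le> norm (T y)" by (simp add: T_sq)
  then have "rinner (R y) y * r\<^sup>2 \<le> norm (T y) * r\<^sup>2"
    by (rule mult_right_mono) simp
  also have "rinner (R y) y * r\<^sup>2 = rinner (R x) x"
    by (simp add: y(2) op_simps power2_eq_square)
  also have "norm (T y) * r\<^sup>2 = norm (T x) * r"
    by (simp add: y(2) op_simps power2_eq_square) (simp add: r_def)
  finally have "2 * u * rinner (R x) x \<le> 2 * u * (norm (T x) * norm x)"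
    using \<open>u > 0\<close> by (simp add: r_def)
  also have "\<dots> \<le> (norm (T x))\<^sup>2 + u\<^sup>2 * (norm x)\<^sup>2"
    using zero_le_power2[of "norm (T x) - u * norm x"]
    by (simp add: power2_eq_square algebra_simps)
  finally show ?thesis .
qed (simp add: op_simps)

theorem theorem2p1:
  fixes A B :: "'a::complex_hilbert_space \<Rightarrow> 'a"
  assumes "positive_op A" and "positive_op B"
    and "invertible_op A"
    and "A \<unlhd> B" and "B \<unlhd> A"
  shows "A = B"
proof -
  obtain S :: "'a \<Rightarrow>\<^sub>L 'a" where S: "psd_op S" "sqrt_op A = blinfun_apply S" "\<And>x. S (S x) = A x"
    using sqrt_op_blinfun[OF assms(1)] by metis
  obtain T :: "'a \<Rightarrow>\<^sub>L 'a" where T: "psd_op T" "sqrt_op B = blinfun_apply T" "\<And>x. T (T x) = B x"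
    using sqrt_op_blinfun[OF assms(2)] by metis
  obtain C where C: "bounded_linear C" "C \<circ> A = id"
    using assms(3) by (auto simp: invertible_op_def bounded_clinear_def)
  obtain b where b: "b > 0" "\<And>x. norm (C x) \<le> norm x * b"
    using bounded_linear.pos_bounded[OF C(1)] by blast
  \<comment> \<open>From C A = id follows |x| <= b |S (S x)| <= b (|S| + 1) |S x|; the summand 1
    excludes a zero denominator.\<close>
  define s where "s = 1 / ((norm S + 1) * b)"
  have "norm S + 1 > 0" by (simp add: add_nonneg_pos)
  then have s: "s > 0" using b(1) by (simp add: s_def)
  have S_below: "norm (s *\<^sub>R x) \<le> norm (S x)" for x
  proof -
    have "norm x = norm (C (A x))" using C(2) by (metis comp_apply id_apply)
    also have "\<dots> \<le> norm (S (S x)) * b" using b(2)[of "A x"] S(3) by simp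
    also have "\<dots> \<le> (norm S + 1) * norm (S x) * b"
      using b(1) norm_blinfun[of S "S x"]
      by (intro mult_right_mono) (auto simp: algebra_simps add_increasing)
    finally have "s * norm x \<le> s * ((norm S + 1) * norm (S x) * b)"
      using s by (intro mult_left_mono) auto
    also have "\<dots> = norm (S x)"
      using \<open>norm S + 1 > 0\<close> b(1) by (simp add: s_def)
    finally show ?thesis using s by simp
  qed
  \<comment> \<open>The norm bound becomes a form bound by comparing s id with
    \<open>S\<close>.\<close>
  have lower: "s * (norm x)\<^sup>2 \<le> rinner (S x) x" for x
  proof -
    have "rinner ((s *\<^sub>R id_blinfun) x) x \<le> rinner (S x) x"
      using s S_below psd_opD[OF S(1)]
      by (intro rinner_mono_of_norm_mono[where c = s]) (auto simp: op_simps rinner_self)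
    then show ?thesis by (simp add: op_simps rinner_self)
  qed
  \<comment> \<open>\<open>k\<close> doublings of \<open>s\<close> reach beyond the norm of
    \<open>S\<close>.\<close>
  obtain k where "norm S / s < 2 ^ k" using real_arch_pow[of 2] by auto
  then have k: "norm S \<le> s * 2 ^ k" using s by (simp add: field_simps)
  have upper: "rinner (S x) x \<le> s * 2 ^ k * (norm x)\<^sup>2" for x
    using rinner_le_norm_blinfun[of S x] mult_right_mono[OF k, of "(norm x)\<^sup>2"] by simp
  have "S = T"
    by (rule eq_of_mutual_form_bounds[OF psd_opD(1)[OF S(1)] T(1) s lower upper])
       (fact root_quad_leD[OF assms(5) T(2) psd_opD(1)[OF S(1)] S(3)]
         root_quad_leD[OF assms(4) S(2) psd_opD(1)[OF T(1)] T(3)])+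
  then show "A = B" using S(3) T(3) by (intro ext) simp
qed

end
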